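(* For the single-machine algorithm $\mathcal{A}$ described in the context, the fractional weighted flow-time in $\mathcal{A}$ of the jobs not in $J^{imm}$ is $O(F^{\mathcal{O}}/\epsilon^2)$, with an absolute constant in $O(\cdot)$.
   Context: Single machine; a finite set of jobs arrives online; job $j$ has integer release time $r_j$, integer processing time $p_j>0$ and weight $w_j>0$; its density is $\rho_j=w_j/p_j$. The parameter $\epsilon$ satisfies $\epsilon^2\le 1/2$ and $1/\epsilon\in\mathbb{Z}$. For $x>0$, $\lfloor x\rfloor_2$ denotes the largest integer $i$ with $2^i\le x$; $\lfloor\rho_j\rfloor_2$ is the density class of $j$. Algorithm $\mathcal{A}$ (which may reject and preempt) works in unit time slots. A job is active at time $t$ if it has been released by $t$, has not finished by $t$ and has not been rejected; $A(t)$ is the active set. $p_j(t)$ is the remaining processing time of $j$ at time $t$ and $w_j(t)=\rho_j p_j(t)$. A set $L$ of "preemptible" jobs is maintained; once a job enters $L$ it stays there until it finishes. At each integer time $t$: (1) each job arriving at $t$ (jobs arriving simultaneously are considered one at a time in a fixed arbitrary order, steps (1)-(2) being done for each) is either immediately rejected by the rule below or added to the active set; (2) if the job $j$ processed in slot $[t-1,t]$ is not in $L$, let $t'$ be the time $\mathcal{A}$ started processing $j$ (so $j$ was processed uninterruptedly during $[t',t]$); if the total weight of jobs arriving during $(t',t]$ exceeds $w_j/\epsilon$, then $j$ is added to $L$; (3) if the job processed in $[t-1,t]$ has not finished and is not in $L$, it is processed in $[t,t+1]$; otherwise $\mathcal{A}$ processes in $[t,t+1]$ an active job of highest density. Immediate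 rejection rule. For an arriving job $j$, $A(r_j)$ denotes the jobs active at time $r_j$, excluding $j$ and excluding jobs arriving at $r_j$ that are considered after $j$. Let $D_j^+=\{j'\in A(r_j):\lfloor\rho_{j'}\rfloor_2\ge\lfloor\rho_j\rfloor_2\}$, $D_j^-=A(r_j)\setminus D_j^+$, $\alpha_j^+=w_j\sum_{j'\in D_j^+,\rho_{j'}\ge\rho_j}p_{j'}(r_j)+p_j\sum_{j'\in D_j^+,\rho_{j'}<\rho_j}w_{j'}(r_j)$, $\alpha_j^-=p_j\sum_{j'\in D_j^-}w_{j'}(r_j)$. Table $T^+$: if $\alpha_j^+\ge w_jp_j/\epsilon$, $j$ is assigned to the bucket $(\lfloor\alpha_j^+/w_j\rfloor_2,\lfloor w_j\rfloor_2)$ of $T^+$; in each bucket of $T^+$, the first job assigned to it is rejected, and then every $(1/\epsilon)$-th subsequent job. Table $T^-$: if $\alpha_j^->w_jp_j/\epsilon$, $j$ is assigned to the bucket $(\lfloor\alpha_j^-\rfloor_2,\lfloor\rho_j\rfloor_2,\lfloor p_j\rfloor_2)$ of $T^-$; in each bucket of $T^-$, every $(1/\epsilon)$-th job assigned to it is rejected (the first rejected one being the $(1/\epsilon)$-th). $J^{imm}$ is the set of jobs rejected upon arrival by this rule. For any schedule, the fractional weighted flow-time of a job $j$ is $\sum_{t\ge r_j}w_j(t)$, where $w_j(t)$ is $\rho_j$ times the remaining processing time of $j$ at time $t$ in that schedule (zero after completion). $\mathcal{O}$ denotes an optimal offline schedule that processes all jobs on the (unit speed) machine, with preemption allowed and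 no rejections, and $F^{\mathcal{O}}$ denotes its (total) fractional weighted flow-time. *)

theory Defs
  imports "HOL-Analysis.Analysis"
begin

text \<open>Jobs are labelled by natural numbers.  Labelling by one fixed countable type makes a constant
  that works for all instances an absolute constant.  Among simultaneously released jobs the order
  of the labels is the order in which they are considered; since labels are arbitrary, this covers
  every such order.\<close>

record job_instance =
  jobs :: "nat set"
  release :: "nat \<Rightarrow> int"
  proc :: "nat \<Rightarrow> nat"
  weight :: "nat \<Rightarrow> real"

definition valid_instance :: "job_instance \<Rightarrow> bool" where
  "valid_instance I \<longleftrightarrow> finite (jobs I) \<and> (\<forall>j\<in>jobs I. 0 < proc I j \<and> 0 < weight I j)"

definition density :: "job_instance \<Rightarrow> nat \<Rightarrow> real" where
  "density I j = weight I j / real (proc I j)"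

definition before :: "job_instance \<Rightarrow> nat \<Rightarrow> nat \<Rightarrow> bool" where
  "before I i j \<longleftrightarrow> release I i < release I j \<or> (release I i = release I j \<and> i < j)"

definition floor2 :: "real \<Rightarrow> int" where
  "floor2 x = (GREATEST i::int. 2 powi i \<le> x)"

lemma floor2_eq_floor_log:
  assumes "0 < x"
  shows "floor2 x = \<lfloor>log 2 x\<rfloor>"
proof -
  have iff: "2 powi i \<le> x \<longleftrightarrow> i \<le> \<lfloor>log 2 x\<rfloor>" for i :: int
  proof -
    have "2 powi i \<le> x \<longleftrightarrow> 2 powr real_of_int i \<le> x"
      by (simp add: powr_real_of_int')
    also have "\<dots> \<longleftrightarrow> real_of_int i \<le> log 2 x"
      using assms by (simp add: le_log_iff)
    also have "\<dots> \<longleftrightarrow> i \<le> \<lfloor>log 2 x\<rfloor>"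
      by (simp add: le_floor_iff)
    finally show ?thesis .
  qed
  show ?thesis
    unfolding floor2_def by (rule Greatest_equality) (auto simp: iff)
qed

subsection \<open>Schedules and fractional weighted flow-time\<close>

text \<open>A schedule is given by the amount \<open>x s j\<close> of job \<open>j\<close> processed during the slot
  \<open>[s, s + 1]\<close>.  Several jobs may share a slot, which accounts for preemption at non-integer times:
  release times are integral and the flow-time only looks at integral times, so how the pieces are
  arranged within a slot is immaterial.\<close>

type_synonym schedule = "int \<Rightarrow> nat \<Rightarrow> real"

definition remaining :: "job_instance \<Rightarrow> schedule \<Rightarrow> nat \<Rightarrow> int \<Rightarrow> real" where
  "remaining I x j t = real (proc I j) - (\<Sum>s\<in>{release I j..<t}. x s j)"

definition remaining_weight :: "job_instance \<Rightarrow> schedule \<Rightarrow> nat \<Rightarrow> int \<Rightarrow> real" where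
  "remaining_weight I x j t = density I j * remaining I x j t"

text \<open>The sum lives in the extended nonnegative reals, so that a job that is never completed
  cannot get a spurious finite flow-time.\<close>

definition frac_flow :: "job_instance \<Rightarrow> schedule \<Rightarrow> nat \<Rightarrow> ennreal" where
  "frac_flow I x j = (\<Sum>\<^sub>\<infinity>t\<in>{release I j..}. ennreal (remaining_weight I x j t))"

definition feasible_schedule :: "job_instance \<Rightarrow> schedule \<Rightarrow> bool" where
  "feasible_schedule I x \<longleftrightarrow>
     (\<forall>s j. 0 \<le> x s j) \<and>
     (\<forall>s j. x s j \<noteq> 0 \<longrightarrow> j \<in> jobs I \<and> release I j \<le> s) \<and>
     (\<forall>s. (\<Sum>j\<in>jobs I. x s j) \<le> 1) \<and>
     (\<forall>j\<in>jobs I. (\<forall>t. 0 \<le> remaining I x j t) \<and> (\<exists>t. remaining I x j t = 0))"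

definition optimal_schedule :: "job_instance \<Rightarrow> schedule \<Rightarrow> bool" where
  "optimal_schedule I x \<longleftrightarrow> feasible_schedule I x \<and>
     (\<forall>y. feasible_schedule I y \<longrightarrow>
        (\<Sum>j\<in>jobs I. frac_flow I x j) \<le> (\<Sum>j\<in>jobs I. frac_flow I y j))"

subsection \<open>The algorithm\<close>

text \<open>A run of the algorithm consists of the job \<open>S t\<close> processed in \<open>[t, t + 1]\<close> (if any), for every
  integer \<open>t\<close>, and the set \<open>R\<close> of jobs rejected on arrival.  The other quantities that the algorithm
  maintains are functions of these two.\<close>

definition slot_schedule :: "(int \<Rightarrow> nat option) \<Rightarrow> schedule" where
  "slot_schedule S = (\<lambda>s j. of_bool (S s = Some j))"

definition active :: "job_instance \<Rightarrow> (int \<Rightarrow> nat option) \<Rightarrow> nat set \<Rightarrow> int \<Rightarrow> nat set" where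
  "active I S R t =
     {j \<in> jobs I. release I j \<le> t \<and> 0 < remaining I (slot_schedule S) j t \<and> j \<notin> R}"

definition active_on_arrival ::
    "job_instance \<Rightarrow> (int \<Rightarrow> nat option) \<Rightarrow> nat set \<Rightarrow> nat \<Rightarrow> nat set" where
  "active_on_arrival I S R j = {i \<in> active I S R (release I j). before I i j}"

definition D_plus :: "job_instance \<Rightarrow> (int \<Rightarrow> nat option) \<Rightarrow> nat set \<Rightarrow> nat \<Rightarrow> nat set" where
  "D_plus I S R j =
     {i \<in> active_on_arrival I S R j. floor2 (density I i) \<ge> floor2 (density I j)}"

definition D_minus :: "job_instance \<Rightarrow> (int \<Rightarrow> nat option) \<Rightarrow> nat set \<Rightarrow> nat \<Rightarrow> nat set" where
  "D_minus I S R j = active_on_arrival I S R j - D_plus I S R j"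

definition alpha_plus :: "job_instance \<Rightarrow> (int \<Rightarrow> nat option) \<Rightarrow> nat set \<Rightarrow> nat \<Rightarrow> real" where
  "alpha_plus I S R j =
     weight I j * (\<Sum>i\<in>{i \<in> D_plus I S R j. density I i \<ge> density I j}.
        remaining I (slot_schedule S) i (release I j)) +
     real (proc I j) * (\<Sum>i\<in>{i \<in> D_plus I S R j. density I i < density I j}.
        remaining_weight I (slot_schedule S) i (release I j))"

definition alpha_minus :: "job_instance \<Rightarrow> (int \<Rightarrow> nat option) \<Rightarrow> nat set \<Rightarrow> nat \<Rightarrow> real" where
  "alpha_minus I S R j =
     real (proc I j) * (\<Sum>i\<in>D_minus I S R j.
        remaining_weight I (slot_schedule S) i (release I j))"

definition assigned_plus ::
    "job_instance \<Rightarrow> real \<Rightarrow> (int \<Rightarrow> nat option) \<Rightarrow> nat set \<Rightarrow> nat \<Rightarrow> bool" where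
  "assigned_plus I \<epsilon> S R j \<longleftrightarrow> alpha_plus I S R j \<ge> weight I j * real (proc I j) / \<epsilon>"

definition assigned_minus ::
    "job_instance \<Rightarrow> real \<Rightarrow> (int \<Rightarrow> nat option) \<Rightarrow> nat set \<Rightarrow> nat \<Rightarrow> bool" where
  "assigned_minus I \<epsilon> S R j \<longleftrightarrow> alpha_minus I S R j > weight I j * real (proc I j) / \<epsilon>"

definition bucket_plus ::
    "job_instance \<Rightarrow> (int \<Rightarrow> nat option) \<Rightarrow> nat set \<Rightarrow> nat \<Rightarrow> int \<times> int" where
  "bucket_plus I S R j = (floor2 (alpha_plus I S R j / weight I j), floor2 (weight I j))"

definition bucket_minus ::
    "job_instance \<Rightarrow> (int \<Rightarrow> nat option) \<Rightarrow> nat set \<Rightarrow> nat \<Rightarrow> int \<times> int \<times> int" where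
  "bucket_minus I S R j =
     (floor2 (alpha_minus I S R j), floor2 (density I j), floor2 (real (proc I j)))"

definition earlier_in_bucket_plus ::
    "job_instance \<Rightarrow> real \<Rightarrow> (int \<Rightarrow> nat option) \<Rightarrow> nat set \<Rightarrow> nat \<Rightarrow> nat set" where
  "earlier_in_bucket_plus I \<epsilon> S R j =
     {i \<in> jobs I. before I i j \<and> assigned_plus I \<epsilon> S R i \<and>
        bucket_plus I S R i = bucket_plus I S R j}"

definition earlier_in_bucket_minus ::
    "job_instance \<Rightarrow> real \<Rightarrow> (int \<Rightarrow> nat option) \<Rightarrow> nat set \<Rightarrow> nat \<Rightarrow> nat set" where
  "earlier_in_bucket_minus I \<epsilon> S R j =
     {i \<in> jobs I. before I i j \<and> assigned_minus I \<epsilon> S R i \<and>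
        bucket_minus I S R i = bucket_minus I S R j}"

text \<open>With \<open>k = 1/\<epsilon>\<close>, a bucket of the first table rejects its jobs number \<open>1, k + 1, 2k + 1, \<dots>\<close>,
  and a bucket of the second table its jobs number \<open>k, 2k, 3k, \<dots>\<close>.\<close>

definition rejected_plus ::
    "job_instance \<Rightarrow> real \<Rightarrow> (int \<Rightarrow> nat option) \<Rightarrow> nat set \<Rightarrow> nat \<Rightarrow> bool" where
  "rejected_plus I \<epsilon> S R j \<longleftrightarrow> assigned_plus I \<epsilon> S R j \<and>
     nat \<lfloor>1 / \<epsilon>\<rfloor> dvd card (earlier_in_bucket_plus I \<epsilon> S R j)"

definition rejected_minus ::
    "job_instance \<Rightarrow> real \<Rightarrow> (int \<Rightarrow> nat option) \<Rightarrow> nat set \<Rightarrow> nat \<Rightarrow> bool" where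
  "rejected_minus I \<epsilon> S R j \<longleftrightarrow> assigned_minus I \<epsilon> S R j \<and>
     nat \<lfloor>1 / \<epsilon>\<rfloor> dvd card (earlier_in_bucket_minus I \<epsilon> S R j) + 1"

text \<open>The set \<open>L\<close> after the second step at time \<open>t\<close>: at some time \<open>s \<le> t\<close> the job that had been
  processed since its start at \<open>t'\<close> passed the weight test.  The total weight counts every job
  released, whether rejected or not.  Jobs of \<open>L\<close> that have finished are harmlessly kept.\<close>

definition preemptible ::
    "job_instance \<Rightarrow> real \<Rightarrow> (int \<Rightarrow> nat option) \<Rightarrow> int \<Rightarrow> nat set" where
  "preemptible I \<epsilon> S t =
     {j. \<exists>s\<le>t. \<exists>t'<s. (\<forall>u<t'. S u \<noteq> Some j) \<and> (\<forall>u\<in>{t'..<s}. S u = Some j) \<and>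
        (\<Sum>i\<in>{i \<in> jobs I. t' < release I i \<and> release I i \<le> s}. weight I i) > weight I j / \<epsilon>}"

text \<open>A job just processed is released and not rejected, so it is unfinished iff it is active.\<close>

definition algorithm_run ::
    "job_instance \<Rightarrow> real \<Rightarrow> (int \<Rightarrow> nat option) \<Rightarrow> nat set \<Rightarrow> bool" where
  "algorithm_run I \<epsilon> S R \<longleftrightarrow>
     R = {j \<in> jobs I. rejected_plus I \<epsilon> S R j \<or> rejected_minus I \<epsilon> S R j} \<and>
     (\<forall>t. if \<exists>j \<in> active I S R t - preemptible I \<epsilon> S t. S (t - 1) = Some j
          then S t = S (t - 1)
          else if active I S R t = {}
          then S t = None
          else \<exists>j \<in> active I S R t. S t = Some j \<and>
                 (\<forall>i \<in> active I S R t. density I i \<le> density I j))"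

end

theory Submission
  imports Defs
begin

text \<open>
  Replacing densities by their classes, the cost of preemptive highest-density-first from a given
  state is up to constants \<open>\<Sum>\<^sub>k 2\<^sup>k A\<^sub>k\<^sup>2\<close>, where \<open>A\<^sub>k\<close> is the active volume of class at least \<open>k\<close>.  An arrival
  of \<open>j\<close> raises it by about \<open>\<alpha>\<^sub>j = \<alpha>\<^sub>j\<^sup>+ + \<alpha>\<^sub>j\<^sup>-\<close>, and a slot lowers it by about the active weight, except that
  a job running non-preemptively delays denser jobs.  Those all arrived after it started, so they
  weigh at most \<open>w\<^sub>j/\<epsilon>\<close>, and all delays together cost at most \<open>\<Sum>\<^sub>j w\<^sub>j p\<^sub>j/\<epsilon> = O(F/\<epsilon>)\<close>, where \<open>F\<close> is the
  flow-time of the optimum.  Hence the flow-time of the algorithm is at most of the order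
  \<open>\<Sum>\<^sub>j \<alpha>\<^sub>j + F/\<epsilon>\<close>.

  With \<open>O\<^sub>k\<close> the corresponding volume of the optimum, the potential \<open>\<Sum>\<^sub>k 2\<^sup>k max(0, A\<^sub>k - O\<^sub>k)\<^sup>2\<close> grows only
  through delays, and a rejected job lowers it by about \<open>\<alpha>\<^sub>j\<close> minus the cost of inserting \<open>j\<close> in the
  optimum.  So the rejected jobs have \<open>\<Sum> \<alpha>\<^sub>j = O(F/\<epsilon>)\<close>.  The buckets charge the other jobs to them at the
  loss of a factor \<open>1/\<epsilon>\<close>, except for the last jobs in each bucket of \<open>T\<^sup>-\<close>.  These contribute
  \<open>O(\<Sum>\<^sub>i 2\<^sup>-\<^sup>i W\<^sub>i\<^sup>2)\<close>, where \<open>W\<^sub>i\<close> is the maximal weight of classes below \<open>i\<close>; by a Hardy-type inequality this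
  is \<open>O(\<Sum>\<^sub>k 2\<^sup>k max\<^sub>t A\<^sub>k(t)\<^sup>2)\<close>, and \<open>A\<^sub>k \<le> O\<^sub>k + max(0, A\<^sub>k - O\<^sub>k)\<close> bounds that by \<open>O(F/\<epsilon>)\<close>.
\<close>

subsection \<open>Sums of powers of two\<close>

lemma floor2_bounds:
  assumes "0 < x"
  shows "2 powi floor2 x \<le> x" "x < 2 * 2 powi floor2 x"
proof -
  have "2 powi floor2 x = 2 powr real_of_int \<lfloor>log 2 x\<rfloor>"
    using assms by (simp add: floor2_eq_floor_log powr_real_of_int')
  moreover have "2 powr real_of_int \<lfloor>log 2 x\<rfloor> \<le> 2 powr log 2 x"
    by (intro powr_mono) auto
  moreover have "2 powr log 2 x < 2 powr (real_of_int \<lfloor>log 2 x\<rfloor> + 1)"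
    by (intro powr_less_mono) linarith+
  ultimately show "2 powi floor2 x \<le> x" "x < 2 * 2 powi floor2 x"
    using assms by (simp_all add: powr_add)
qed

lemma floor2_mono:
  assumes "0 < x" "x \<le> y"
  shows "floor2 x \<le> floor2 y"
  using assms by (simp add: floor2_eq_floor_log floor_mono)

text \<open>A geometric sum over any finite set of integer exponents is dominated by its largest
  term: peeling off the maximum \<open>b\<close> leaves exponents at most \<open>b - 1\<close>, and
  the factor \<open>q / (q - 1)\<close> reproduces itself.\<close>

lemma sum_powi_le:
  fixes q :: real
  assumes "finite X" "1 < q" "\<And>x. x \<in> X \<Longrightarrow> x \<le> m"
  shows "(\<Sum>x\<in>X. q powi x) \<le> q / (q - 1) * q powi m"
  using assms(1,3)
proof (induction X arbitrary: m rule: finite_linorder_max_induct)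
  case empty
  then show ?case using assms(2) by simp
next
  case (insert b X)
  have "(\<Sum>x\<in>X. q powi x) \<le> q / (q - 1) * q powi (b - 1)"
    using insert by (intro insert.IH) force
  moreover have "q powi b = q * q powi (b - 1)"
    using assms(2) power_int_add_1'[of q "b - 1"] by simp
  ultimately have "(\<Sum>x\<in>insert b X. q powi x) \<le> q / (q - 1) * q powi b"
    using insert.hyps assms(2) by (auto simp: field_simps)
  also have "\<dots> \<le> q / (q - 1) * q powi m"
    using insert.prems assms(2) by (intro mult_left_mono power_int_increasing) auto
  finally show ?case .
qed

lemma sum_powi2_le:
  assumes "finite X" "0 \<le> c" "\<And>x. x \<in> X \<Longrightarrow> 2 powi x \<le> c"
  shows "(\<Sum>x\<in>X. 2 powi x) \<le> 2 * (c::real)"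
proof (cases "X = {}")
  case False
  have "(\<Sum>x\<in>X. 2 powi x) \<le> 2 * (2::real) powi Max X"
    using sum_powi_le[OF assms(1), of 2 "Max X"] assms(1) by simp
  also have "\<dots> \<le> 2 * c"
    using assms False by simp
  finally show ?thesis .
qed (use assms in simp)

text \<open>A discrete Hardy inequality by weighted Cauchy-Schwarz. The weight base
  \<open>3/2\<close> lies strictly between 1 and 2: above 1 so that the sum over
  \<open>k < i\<close> is dominated by its top term, below 2 so that division by
  \<open>2 powi i\<close> leaves the decaying \<open>(3/4) powi i\<close>, which can be summed over
  \<open>i > k\<close>.\<close>

lemma hardy_powi:
  fixes M :: "int \<Rightarrow> real"
  assumes "finite K"
  shows "(\<Sum>i\<in>K. (\<Sum>k\<in>{k\<in>K. k < i}. 2 powi k * M k)\<^sup>2 / 2 powi i)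
    \<le> 6 * (\<Sum>k\<in>K. 2 powi k * (M k)\<^sup>2)"
proof -
  have CS: "(\<Sum>k\<in>{k\<in>K. k < i}. 2 powi k * M k)\<^sup>2 / 2 powi i
      \<le> (\<Sum>k\<in>{k\<in>K. k < i}. 2 * (3/4) powi i * ((8/3) powi k * (M k)\<^sup>2))" for i
  proof -
    let ?X = "{k\<in>K. k < i}"
    let ?s = "\<lambda>k. sqrt ((3/2) powi k)" and ?u = "\<lambda>k. sqrt ((8/3) powi k) * M k"
    \<comment> \<open>The bases multiply to 4, whose powers have the powers of 2 as square
      roots.\<close>
    have split: "2 powi k = ?s k * sqrt ((8/3) powi k)" for k :: int
    proof -
      have "?s k * sqrt ((8/3) powi k) = sqrt ((2 powi k)\<^sup>2)"
        by (simp only: real_sqrt_mult[symmetric] power_int_mult_distrib[symmetric] power2_eq_square) simp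
      then show ?thesis by simp
    qed
    have "(\<Sum>k\<in>?X. 2 powi k * M k)\<^sup>2 = (\<Sum>k\<in>?X. ?s k * ?u k)\<^sup>2"
      by (subst split) (simp add: mult.assoc)
    also have "\<dots> \<le> (\<Sum>k\<in>?X. (?s k)\<^sup>2) * (\<Sum>k\<in>?X. (?u k)\<^sup>2)"
      by (rule Cauchy_Schwarz_ineq_sum)
    also have "\<dots> = (\<Sum>k\<in>?X. (3/2) powi k) * (\<Sum>k\<in>?X. (8/3) powi k * (M k)\<^sup>2)"
      by (simp add: power_mult_distrib)
    also have "\<dots> \<le> (2 * (3/2) powi i) * (\<Sum>k\<in>?X. (8/3) powi k * (M k)\<^sup>2)"
    proof (intro mult_right_mono sum_nonneg)
      have "(\<Sum>k\<in>?X. (3/2) powi k) \<le> (3/2) / (3/2 - 1) * (3/2 :: real) powi (i - 1)"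
        using assms by (intro sum_powi_le) auto
      also have "\<dots> = 2 * (3/2) powi i"
        by (simp add: power_int_diff)
      finally show "(\<Sum>k\<in>?X. (3/2) powi k) \<le> 2 * (3/2 :: real) powi i" .
    qed auto
    finally have "(\<Sum>k\<in>?X. 2 powi k * M k)\<^sup>2 / 2 powi i
        \<le> 2 * ((3/2) powi i / 2 powi i) * (\<Sum>k\<in>?X. (8/3) powi k * (M k)\<^sup>2)"
      by (simp add: divide_right_mono)
    also have "(3/2) powi i / 2 powi i = (3/4 :: real) powi i"
      by (simp add: power_int_divide_distrib[symmetric])
    finally show ?thesis by (simp add: sum_distrib_left)
  qed
  \<comment> \<open>Negating the exponents turns the decaying sum into a growing one with base
    \<open>4/3\<close>, to which \<open>sum_powi_le\<close> applies.\<close>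
  have tail: "(\<Sum>i\<in>{i\<in>K. k < i}. (3/4) powi i) \<le> 3 * (3/4 :: real) powi k" for k
  proof -
    have "(\<Sum>i\<in>{i\<in>K. k < i}. (3/4) powi i) = (\<Sum>i\<in>uminus ` {i\<in>K. k < i}. (4/3 :: real) powi i)"
      by (subst sum.reindex)
        (auto intro!: sum.cong simp: power_int_minus power_int_divide_distrib)
    also have "\<dots> \<le> (4/3) / (4/3 - 1) * (4/3) powi (- k - 1)"
      using assms by (intro sum_powi_le) auto
    also have "\<dots> = 3 * (3/4) powi k"
      by (simp add: power_int_diff power_int_minus power_int_divide_distrib field_simps)
    finally show ?thesis .
  qed
  have "(\<Sum>i\<in>K. (\<Sum>k\<in>{k\<in>K. k < i}. 2 powi k * M k)\<^sup>2 / 2 powi i)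
      \<le> (\<Sum>i\<in>K. \<Sum>k\<in>{k\<in>K. k < i}. 2 * (3/4) powi i * ((8/3) powi k * (M k)\<^sup>2))"
    by (intro sum_mono CS)
  also have "\<dots> = (\<Sum>k\<in>K. \<Sum>i\<in>{i\<in>K. k < i}. 2 * (3/4) powi i * ((8/3) powi k * (M k)\<^sup>2))"
    using assms by (intro sum.swap_restrict) auto
  also have "\<dots> = (\<Sum>k\<in>K. 2 * (\<Sum>i\<in>{i\<in>K. k < i}. (3/4) powi i) * ((8/3) powi k * (M k)\<^sup>2))"
    by (simp add: sum_distrib_left sum_distrib_right)
  also have "\<dots> \<le> (\<Sum>k\<in>K. 2 * (3 * (3/4) powi k) * ((8/3) powi k * (M k)\<^sup>2))"
    by (intro sum_mono mult_right_mono mult_left_mono tail) auto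
  also have "\<dots> = (\<Sum>k\<in>K. 6 * (2 powi k * (M k)\<^sup>2))"
  proof (intro sum.cong refl)
    fix k
    have "(3/4 :: real) powi k * (8/3) powi k = 2 powi k"
      by (simp add: power_int_mult_distrib[symmetric])
    then show "2 * (3 * (3/4) powi k) * ((8/3) powi k * (M k)\<^sup>2) = 6 * (2 powi k * (M k)\<^sup>2)"
      by (metis (no_types, opaque_lifting) mult.assoc mult.left_commute mult_numeral_left_semiring_numeral semiring_norm(14,12,13))
  qed
  finally show ?thesis by (simp add: sum_distrib_left)
qed

subsection \<open>Telescoping along arrivals\<close>

text \<open>Jobs released together are added one at a time in label order, so that each has its own
  increment of \<open>f\<close>.\<close>

lemma batch_telescope:
  fixes f :: "real \<Rightarrow> real" and B :: "nat set"
  assumes "finite B"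
  shows "f (x + (\<Sum>j\<in>B. d j)) = f x +
    (\<Sum>j\<in>B. f (x + (\<Sum>i\<in>{i\<in>B. i < j}. d i) + d j) - f (x + (\<Sum>i\<in>{i\<in>B. i < j}. d i)))"
  using assms
proof (induction B rule: finite_linorder_max_induct)
  case (insert b B)
  have "{i \<in> insert b B. i < b} = B"
    using insert.hyps by auto
  moreover have "{i \<in> insert b B. i < j} = {i \<in> B. i < j}" if "j \<in> B" for j
    using insert.hyps that by auto
  moreover have "b \<notin> B"
    using insert.hyps by auto
  ultimately show ?case
    using insert by (simp add: algebra_simps cong: sum.cong)
qed simp

text \<open>\<open>X\<close> is any quantity made of jumps \<open>d\<close> at arrivals and changes
  \<open>g\<close> in slots; \<open>x j\<close> is its value just before \<open>j\<close> is added.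
  All potential arguments below thus reduce to single slots and single arrivals.\<close>

lemma arrival_telescope:
  fixes f :: "real \<Rightarrow> real" and I :: job_instance and d :: "nat \<Rightarrow> real" and g :: "int \<Rightarrow> real"
    and a :: int
  defines "X t \<equiv> (\<Sum>j\<in>{j\<in>jobs I. release I j \<le> t}. d j) + (\<Sum>s\<in>{a..<t}. g s)"
  defines "x j \<equiv> (\<Sum>i\<in>{i\<in>jobs I. before I i j}. d i) + (\<Sum>s\<in>{a..<release I j}. g s)"
  assumes "finite (jobs I)" and a: "\<And>j. j \<in> jobs I \<Longrightarrow> a < release I j" and "a \<le> T"
  shows "f (X T) = f 0 + (\<Sum>t\<in>{a..<T}. f (X t + g t) - f (X t)) +
    (\<Sum>j\<in>{j\<in>jobs I. release I j \<le> T}. f (x j + d j) - f (x j))"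
  using \<open>a \<le> T\<close>
proof (induction T rule: int_ge_induct)
  case base
  have empty: "{j\<in>jobs I. release I j \<le> a} = {}"
    using a by force
  show ?case unfolding X_def empty by simp
next
  case (step T)
  let ?B = "{j\<in>jobs I. release I j = T + 1}"
  have fin: "finite ?B" using assms(3) by simp
  have split: "{j\<in>jobs I. release I j \<le> T + 1} = {j\<in>jobs I. release I j \<le> T} \<union> ?B"
    "{j\<in>jobs I. release I j \<le> T} \<inter> ?B = {}"
    by auto
  have slots: "{a..<T + 1} = insert T {a..<T}"
    using step.hyps by auto
  have union: "(\<Sum>j\<in>{j\<in>jobs I. release I j \<le> T + 1}. h j) =
      (\<Sum>j\<in>{j\<in>jobs I. release I j \<le> T}. h j) + (\<Sum>j\<in>?B. h j)" for h :: "nat \<Rightarrow> real"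
    unfolding split(1) using assms(3) by (intro sum.union_disjoint split(2)) auto
  have sum_slots: "(\<Sum>s\<in>{a..<T + 1}. h s) = (\<Sum>s\<in>{a..<T}. h s) + h T" for h :: "int \<Rightarrow> real"
    unfolding slots by simp
  \<comment> \<open>Slot \<open>T\<close> is processed first, then the jobs released at
    \<open>T + 1\<close> arrive.\<close>
  have X: "X (T + 1) = (X T + g T) + (\<Sum>j\<in>?B. d j)"
    unfolding X_def union sum_slots by simp
  have x: "x j = X T + g T + (\<Sum>i\<in>{i\<in>?B. i < j}. d i)" if "j \<in> ?B" for j
  proof -
    have r: "release I j = T + 1"
      using that by simp
    have "{i\<in>jobs I. before I i j} = {j\<in>jobs I. release I j \<le> T} \<union> {i\<in>?B. i < j}"
      using r by (auto simp: before_def)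
    moreover have "(\<Sum>i\<in>{j\<in>jobs I. release I j \<le> T} \<union> {i\<in>?B. i < j}. d i) =
        (\<Sum>i\<in>{j\<in>jobs I. release I j \<le> T}. d i) + (\<Sum>i\<in>{i\<in>?B. i < j}. d i)"
      using assms(3) by (intro sum.union_disjoint) auto
    ultimately show ?thesis
      unfolding x_def X_def r sum_slots by simp
  qed
  have "f (X (T + 1)) = f (X T + g T) + (\<Sum>j\<in>?B. f (x j + d j) - f (x j))"
    unfolding X batch_telescope[OF fin, of f]
    by (intro arg_cong2[of _ _ _ _ "(+)"] sum.cong refl) (simp only: x)
  then show ?case
    unfolding union sum_slots using step.IH by linarith
qed

subsection \<open>Counting in buckets\<close>

lemma before_trans: "before I i j \<Longrightarrow> before I j k \<Longrightarrow> before I i k"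
  by (auto simp: before_def)

lemma before_total: "i \<noteq> j \<Longrightarrow> before I i j \<or> before I j i"
  by (auto simp: before_def)

lemma before_irrefl: "\<not> before I i i"
  by (simp add: before_def)

text \<open>Predecessor counts increase strictly along the linear order \<open>before\<close>, hence
  are distinct; all lie below \<open>card B\<close>, so they exhaust the ranks.\<close>

lemma bij_betw_rank:
  assumes "finite B"
  shows "bij_betw (\<lambda>j. card {i\<in>B. before I i j}) B {..<card B}"
proof -
  have less: "card {h\<in>B. before I h i} < card {h\<in>B. before I h j}"
    if "before I i j" "i \<in> B" for i j
  proof (rule psubset_card_mono)
    show "{h\<in>B. before I h i} \<subset> {h\<in>B. before I h j}"
    proof (intro psubsetI)
      show "{h\<in>B. before I h i} \<subseteq> {h\<in>B. before I h j}"
        using that(1) by (auto intro: before_trans)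
      show "{h\<in>B. before I h i} \<noteq> {h\<in>B. before I h j}"
        using that before_irrefl[of I i] by (metis (no_types, lifting) mem_Collect_eq)
    qed
  qed (use assms in simp)
  have inj: "inj_on (\<lambda>j. card {i\<in>B. before I i j}) B"
  proof (rule inj_onI, rule ccontr)
    fix i j assume "i \<in> B" "j \<in> B" "card {h\<in>B. before I h i} = card {h\<in>B. before I h j}" "i \<noteq> j"
    then show False
      using less[of i j] less[of j i] before_total[of i j I] by auto
  qed
  have "(\<lambda>j. card {i\<in>B. before I i j}) ` B \<subseteq> {..<card B}"
  proof clarify
    fix j assume "j \<in> B"
    moreover have "j \<notin> {i\<in>B. before I i j}" by (simp add: before_irrefl)
    ultimately have "{i\<in>B. before I i j} \<subset> B" by blast
    then show "card {i\<in>B. before I i j} < card B"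
      by (rule psubset_card_mono[OF assms])
  qed
  then have "(\<lambda>j. card {i\<in>B. before I i j}) ` B = {..<card B}"
    using inj by (intro card_subset_eq) (simp_all only: finite_lessThan card_image card_lessThan)
  then show ?thesis
    using inj by (simp only: bij_betw_def)
qed

text \<open>Whether a bucket rejects a job depends only on the job's rank there, so counting
  rejections becomes counting integers.\<close>

lemma card_rank_filter:
  assumes "finite B"
  shows "card {j\<in>B. P (card {i\<in>B. before I i j})} = card {m. m < card B \<and> P m}"
proof -
  let ?r = "\<lambda>j. card {i\<in>B. before I i j}"
  have bij: "inj_on ?r B" "?r ` B = {..<card B}"
    using bij_betw_rank[OF assms, of I] unfolding bij_betw_def by blast+
  have "{m. m < card B \<and> P m} = ?r ` {j\<in>B. P (?r j)}"
  proof (intro equalityI subsetI)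
    fix m assume "m \<in> {m. m < card B \<and> P m}"
    then obtain j where "j \<in> B" "m = ?r j" "P m"
      using bij(2) by (metis (no_types, lifting) imageE lessThan_iff mem_Collect_eq)
    then show "m \<in> ?r ` {j\<in>B. P (?r j)}" by blast
  next
    fix m assume "m \<in> ?r ` {j\<in>B. P (?r j)}"
    then obtain j where "j \<in> B" "P (?r j)" "m = ?r j" by blast
    then show "m \<in> {m. m < card B \<and> P m}"
      using bij(2) by (metis (no_types, lifting) imageI lessThan_iff mem_Collect_eq)
  qed
  moreover have "inj_on ?r {j\<in>B. P (?r j)}"
    using bij(1) by (rule inj_on_subset) blast
  ultimately show ?thesis by (simp only: card_image)
qed

text \<open>Each number lies in the block of length \<open>N\<close> starting at the last multiple
  of \<open>N\<close> up to it. Rank 0 is marked, so nothing stays uncovered; this is the rejection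
  pattern of \<open>T\<^sup>+\<close>.\<close>

lemma le_mult_card_dvd:
  assumes "0 < (N::nat)"
  shows "n \<le> N * card {m. m < n \<and> N dvd m}"
proof -
  let ?M = "{m. m < n \<and> N dvd m}"
  have "{..<n} \<subseteq> (\<Union>m\<in>?M. {m..<m + N})"
  proof
    fix x assume "x \<in> {..<n}"
    then have "N * (x div N) \<in> ?M" "x \<in> {N * (x div N)..<N * (x div N) + N}"
      using assms by (auto intro: le_less_trans[OF times_div_less_eq_dividend] simp: dividend_less_times_div add.commute)
    then show "x \<in> (\<Union>m\<in>?M. {m..<m + N})" by blast
  qed
  then have "card {..<n} \<le> card (\<Union>m\<in>?M. {m..<m + N})"
    by (intro card_mono) auto
  also have "\<dots> \<le> (\<Sum>m\<in>?M. card {m..<m + N})"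
    by (rule card_UN_le) simp
  finally show ?thesis by (simp add: mult.commute)
qed

text \<open>For \<open>T\<^sup>-\<close> the marked ranks are one less than the positive multiples
  of \<open>N\<close>, and each covers the \<open>N\<close> ranks after it. The first
  \<open>N\<close> ranks stay uncovered and give the extra term.\<close>

lemma le_mult_card_dvd_Suc:
  assumes "0 < (N::nat)"
  shows "n \<le> N * card {m. m < n \<and> N dvd m + 1} + N"
proof -
  let ?M = "{m. m < n \<and> N dvd m + 1}"
  have "{..<n} \<subseteq> (\<Union>m\<in>?M. {m + 1..<m + 1 + N}) \<union> {..<N}"
  proof
    fix x assume x: "x \<in> {..<n}"
    show "x \<in> (\<Union>m\<in>?M. {m + 1..<m + 1 + N}) \<union> {..<N}"
    proof (cases "x < N")
      case False
      define y where "y = N * (x div N)"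
      have y: "0 < y" "y \<le> x" "x < y + N"
        using False assms by (auto simp: y_def div_greater_zero_iff dividend_less_times_div add.commute)
      moreover have "N dvd y" by (simp add: y_def)
      ultimately have "y - 1 \<in> ?M" "x \<in> {y - 1 + 1..<y - 1 + 1 + N}"
        using x by auto
      then show ?thesis by blast
    qed simp
  qed
  then have "card {..<n} \<le> card ((\<Union>m\<in>?M. {m + 1..<m + 1 + N}) \<union> {..<N})"
    by (intro card_mono) auto
  also have "\<dots> \<le> card (\<Union>m\<in>?M. {m + 1..<m + 1 + N}) + N"
    using card_Un_le[of _ "{..<N}"] by simp
  also have "card (\<Union>m\<in>?M. {m + 1..<m + 1 + N}) \<le> (\<Sum>m\<in>?M. card {m + 1..<m + 1 + N})"
    by (rule card_UN_le) simp
  finally show ?thesis by (simp add: mult.commute)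
qed

text \<open>Within a bucket all values of \<open>g\<close> agree with the scale \<open>lo\<close> up
  to the factor \<open>c\<close>, so a job can be charged to any rejected job of its bucket. One
  rejection pays for \<open>N\<close> jobs, and \<open>M\<close> jobs per bucket may stay
  unpaid.\<close>

lemma bucket_sum_le:
  fixes g :: "'a \<Rightarrow> real" and lo :: "'b \<Rightarrow> real"
  assumes "finite P" and bounds: "\<And>j. j \<in> P \<Longrightarrow> 0 \<le> lo (b j) \<and> lo (b j) \<le> g j \<and> g j \<le> c * lo (b j)"
    and "0 \<le> c" and card: "\<And>\<beta>. \<beta> \<in> b ` P \<Longrightarrow> card {j\<in>P. b j = \<beta>} \<le> N * card {j\<in>{j\<in>P. rej j}. b j = \<beta>} + M"
  shows "(\<Sum>j\<in>P. g j) \<le> c * real N * (\<Sum>j\<in>{j\<in>P. rej j}. g j) + (\<Sum>\<beta>\<in>b ` P. real M * c * lo \<beta>)"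
proof -
  have bucket: "(\<Sum>j\<in>{j\<in>P. b j = \<beta>}. g j)
      \<le> c * real N * (\<Sum>j\<in>{j\<in>{j\<in>P. rej j}. b j = \<beta>}. g j) + real M * c * lo \<beta>"
    if \<beta>: "\<beta> \<in> b ` P" for \<beta>
  proof -
    have nonneg: "0 \<le> c * lo \<beta>"
      using \<beta> bounds \<open>0 \<le> c\<close> by auto
    have "(\<Sum>j\<in>{j\<in>P. b j = \<beta>}. g j) \<le> (\<Sum>j\<in>{j\<in>P. b j = \<beta>}. c * lo \<beta>)"
      using bounds by (intro sum_mono) auto
    also have "\<dots> = real (card {j\<in>P. b j = \<beta>}) * (c * lo \<beta>)"
      by simp
    also have "\<dots> \<le> real (N * card {j\<in>{j\<in>P. rej j}. b j = \<beta>} + M) * (c * lo \<beta>)"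
      using card[OF \<beta>] nonneg by (intro mult_right_mono) (simp_all only: of_nat_le_iff)
    also have "\<dots> = c * real N * (\<Sum>j\<in>{j\<in>{j\<in>P. rej j}. b j = \<beta>}. lo \<beta>) + real M * c * lo \<beta>"
      by (simp add: algebra_simps)
    also have "\<dots> \<le> c * real N * (\<Sum>j\<in>{j\<in>{j\<in>P. rej j}. b j = \<beta>}. g j) + real M * c * lo \<beta>"
      using bounds \<open>0 \<le> c\<close> by (intro add_right_mono mult_left_mono sum_mono) auto
    finally show ?thesis .
  qed
  have "(\<Sum>j\<in>P. g j) = (\<Sum>\<beta>\<in>b ` P. \<Sum>j\<in>{j\<in>P. b j = \<beta>}. g j)"
    using assms(1) by (rule sum.image_gen)
  also have "\<dots> \<le> (\<Sum>\<beta>\<in>b ` P. c * real N * (\<Sum>j\<in>{j\<in>{j\<in>P. rej j}. b j = \<beta>}. g j) + real M * c * lo \<beta>)"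
    by (intro sum_mono bucket)
  also have "\<dots> = c * real N * (\<Sum>\<beta>\<in>b ` P. \<Sum>j\<in>{j\<in>{j\<in>P. rej j}. b j = \<beta>}. g j) + (\<Sum>\<beta>\<in>b ` P. real M * c * lo \<beta>)"
    by (simp add: sum.distrib sum_distrib_left)
  also have "(\<Sum>\<beta>\<in>b ` P. \<Sum>j\<in>{j\<in>{j\<in>P. rej j}. b j = \<beta>}. g j) = (\<Sum>j\<in>{j\<in>P. rej j}. g j)"
    using assms(1) by (intro sum.group) auto
  finally show ?thesis .
qed

subsection \<open>Volumes of schedules\<close>

definition vol :: "job_instance \<Rightarrow> schedule \<Rightarrow> nat set \<Rightarrow> int \<Rightarrow> real" where
  "vol I y G t = (\<Sum>i\<in>{i\<in>G. release I i \<le> t}. remaining I y i t)"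

definition vol_before :: "job_instance \<Rightarrow> schedule \<Rightarrow> nat set \<Rightarrow> nat \<Rightarrow> real" where
  "vol_before I y G j = (\<Sum>i\<in>{i\<in>G. before I i j}. remaining I y i (release I j))"

text \<open>The part of feasibility that the run shares, although it never completes its rejected
  jobs.\<close>

definition respects_releases :: "job_instance \<Rightarrow> schedule \<Rightarrow> bool" where
  "respects_releases I y \<longleftrightarrow> (\<forall>s. \<forall>i\<in>jobs I. s < release I i \<longrightarrow> y s i = 0)"

lemma remaining_step:
  assumes "respects_releases I y" "i \<in> jobs I"
  shows "remaining I y i (t + 1) = remaining I y i t - y t i"
proof (cases "release I i \<le> t")
  case True
  then have "{release I i..<t + 1} = insert t {release I i..<t}" by auto
  then show ?thesis by (simp add: remaining_def)
next
  case False
  then have "{release I i..<t + 1} = {}" "{release I i..<t} = {}" "y t i = 0"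
    using assms by (auto simp: respects_releases_def)
  then show ?thesis unfolding remaining_def by simp
qed

text \<open>Jobs of \<open>G\<close> outside \<open>P\<close> have received no work before
  \<open>t\<close>, so the work on \<open>P\<close> is all the work on \<open>G\<close>. This puts
  both \<open>vol\<close> and \<open>vol_before\<close> into the form required by
  \<open>arrival_telescope\<close>.\<close>

lemma sum_remaining:
  assumes "finite G" "G \<subseteq> jobs I" "respects_releases I y" "\<And>i. i \<in> G \<Longrightarrow> a < release I i"
    and P: "P \<subseteq> G" "\<And>i. i \<in> G - P \<Longrightarrow> t \<le> release I i"
  shows "(\<Sum>i\<in>P. remaining I y i t) =
    (\<Sum>i\<in>P. real (proc I i)) + (\<Sum>s\<in>{a..<t}. - (\<Sum>i\<in>G. y s i))"
proof -
  have zero: "y s i = 0" if "i \<in> G" "s < release I i" for s i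
    using that assms(2,3) by (auto simp: respects_releases_def)
  have "(\<Sum>i\<in>P. \<Sum>s\<in>{release I i..<t}. y s i) = (\<Sum>i\<in>P. \<Sum>s\<in>{a..<t}. y s i)"
  proof (rule sum.cong[OF refl])
    fix i assume "i \<in> P"
    then have i: "i \<in> G" "a < release I i" using P(1) assms(4) by auto
    show "(\<Sum>s\<in>{release I i..<t}. y s i) = (\<Sum>s\<in>{a..<t}. y s i)"
      using i by (intro sum.mono_neutral_left) (auto intro: zero)
  qed
  also have "\<dots> = (\<Sum>i\<in>G. \<Sum>s\<in>{a..<t}. y s i)"
  proof (intro sum.mono_neutral_left ballI sum.neutral)
    fix i s assume "i \<in> G - P" "s \<in> {a..<t}"
    then show "y s i = 0" using P(2)[of i] by (intro zero) auto
  qed (use P assms(1) in auto)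
  also have "\<dots> = (\<Sum>s\<in>{a..<t}. \<Sum>i\<in>G. y s i)"
    by (rule sum.swap)
  finally show ?thesis
    by (simp add: remaining_def sum_subtractf sum_negf)
qed

text \<open>The volume between the end of slot \<open>t\<close> and the arrivals at
  \<open>t + 1\<close>; written as a sum of remaining times it is visibly nonnegative.\<close>

lemma vol_step:
  assumes "finite G" "G \<subseteq> jobs I" "respects_releases I y"
  shows "vol I y G t - (\<Sum>i\<in>G. y t i) = (\<Sum>i\<in>{i\<in>G. release I i \<le> t}. remaining I y i (t + 1))"
proof -
  have "(\<Sum>i\<in>G. y t i) = (\<Sum>i\<in>{i\<in>G. release I i \<le> t}. y t i)"
  proof (intro sum.mono_neutral_right ballI)
    fix i assume "i \<in> G - {i\<in>G. release I i \<le> t}"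
    then show "y t i = 0" using assms(2,3) by (auto simp: respects_releases_def)
  qed (use assms(1) in auto)
  moreover have "(\<Sum>i\<in>{i\<in>G. release I i \<le> t}. remaining I y i (t + 1)) =
      (\<Sum>i\<in>{i\<in>G. release I i \<le> t}. remaining I y i t - y t i)"
    using assms by (intro sum.cong refl remaining_step) auto
  ultimately show ?thesis by (simp add: vol_def sum_subtractf)
qed

lemma vol_eq:
  assumes "finite (jobs I)" "G \<subseteq> jobs I" "respects_releases I y" "\<And>i. i \<in> jobs I \<Longrightarrow> a < release I i"
  shows "vol I y G t = (\<Sum>j\<in>{j\<in>jobs I. release I j \<le> t}. if j \<in> G then real (proc I j) else 0)
    + (\<Sum>s\<in>{a..<t}. - (\<Sum>i\<in>G. y s i))"
proof -
  have "(\<Sum>j\<in>{j\<in>jobs I. release I j \<le> t}. if j \<in> G then real (proc I j) else 0) =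
      (\<Sum>j\<in>{i\<in>G. release I i \<le> t}. real (proc I j))"
    using assms(1,2) by (subst sum.inter_filter[symmetric]) (auto intro!: sum.cong)
  moreover have "finite G" using assms(1,2) by (rule rev_finite_subset)
  ultimately show ?thesis
    unfolding vol_def using assms by (subst sum_remaining[where G = G and a = a]) auto
qed

lemma vol_before_eq:
  assumes "finite (jobs I)" "G \<subseteq> jobs I" "respects_releases I y" "\<And>i. i \<in> jobs I \<Longrightarrow> a < release I i"
  shows "vol_before I y G j = (\<Sum>i\<in>{i\<in>jobs I. before I i j}. if i \<in> G then real (proc I i) else 0)
    + (\<Sum>s\<in>{a..<release I j}. - (\<Sum>i\<in>G. y s i))"
proof -
  have "(\<Sum>i\<in>{i\<in>jobs I. before I i j}. if i \<in> G then real (proc I i) else 0) =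
      (\<Sum>i\<in>{i\<in>G. before I i j}. real (proc I i))"
    using assms(1,2) by (subst sum.inter_filter[symmetric]) (auto intro!: sum.cong)
  moreover have "finite G" using assms(1,2) by (rule rev_finite_subset)
  ultimately show ?thesis
    unfolding vol_before_def using assms
    by (subst sum_remaining[where G = G and a = a]) (auto simp: before_def)
qed

lemma vol_telescope:
  fixes f :: "real \<Rightarrow> real"
  assumes "finite (jobs I)" "G \<subseteq> jobs I" "respects_releases I y"
    and "\<And>i. i \<in> jobs I \<Longrightarrow> a < release I i" "a \<le> T"
  shows "f (vol I y G T) = f 0
    + (\<Sum>t\<in>{a..<T}. f (vol I y G t - (\<Sum>i\<in>G. y t i)) - f (vol I y G t))
    + (\<Sum>j\<in>{j\<in>G. release I j \<le> T}.
        f (vol_before I y G j + real (proc I j)) - f (vol_before I y G j))"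
proof -
  let ?d = "\<lambda>j. if j \<in> G then real (proc I j) else 0"
  have "(\<Sum>j\<in>{j\<in>G. release I j \<le> T}. f (vol_before I y G j + real (proc I j)) - f (vol_before I y G j))
      = (\<Sum>j\<in>{j\<in>jobs I. release I j \<le> T}. f (vol_before I y G j + ?d j) - f (vol_before I y G j))"
    using assms(1,2) by (intro sum.mono_neutral_cong_left) auto
  then show ?thesis
    using arrival_telescope[where I = I and d = ?d and g = "\<lambda>s. - (\<Sum>i\<in>G. y s i)" and f = f
        and a = a and T = T] assms(1,4,5)
    by (simp only: vol_eq[OF assms(1-4), symmetric] vol_before_eq[OF assms(1-4), symmetric]
        add_uminus_conv_diff)
qed

text \<open>Arrivals in \<open>G\<close> enter both volumes and cancel, so only \<open>H - G\<close>
  leaves arrival terms. With the accepted jobs as \<open>G\<close> and all jobs as \<open>H\<close>,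
  these are the rejected jobs.\<close>

lemma vol_diff_telescope:
  fixes f :: "real \<Rightarrow> real"
  assumes "finite (jobs I)" "G \<subseteq> H" "H \<subseteq> jobs I" "respects_releases I y" "respects_releases I z"
    and a: "\<And>i. i \<in> jobs I \<Longrightarrow> a < release I i" "a \<le> T"
  defines "D t \<equiv> vol I y G t - vol I z H t"
    and "E j \<equiv> vol_before I y G j - vol_before I z H j"
  shows "f (D T) = f 0
    + (\<Sum>t\<in>{a..<T}. f (D t - ((\<Sum>i\<in>G. y t i) - (\<Sum>i\<in>H. z t i))) - f (D t))
    + (\<Sum>j\<in>{j\<in>H - G. release I j \<le> T}. f (E j - real (proc I j)) - f (E j))"
proof -
  let ?d = "\<lambda>j. (if j \<in> G then real (proc I j) else 0) - (if j \<in> H then real (proc I j) else 0)"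
  let ?g = "\<lambda>s. - (\<Sum>i\<in>G. y s i) - - (\<Sum>i\<in>H. z s i)"
  have GJ: "G \<subseteq> jobs I" using assms by blast
  have D: "D t = (\<Sum>j\<in>{j\<in>jobs I. release I j \<le> t}. ?d j) + (\<Sum>s\<in>{a..<t}. ?g s)" for t
    using vol_eq[OF assms(1) GJ assms(4) a(1), of t] vol_eq[OF assms(1,3,5) a(1), of t]
    by (simp only: D_def sum_subtractf)
  have E: "E j = (\<Sum>i\<in>{i\<in>jobs I. before I i j}. ?d i) + (\<Sum>s\<in>{a..<release I j}. ?g s)" for j
    using vol_before_eq[OF assms(1) GJ assms(4) a(1), of j] vol_before_eq[OF assms(1,3,5) a(1), of j]
    by (simp only: E_def sum_subtractf)
  have "(\<Sum>j\<in>{j\<in>H - G. release I j \<le> T}. f (E j - real (proc I j)) - f (E j))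
      = (\<Sum>j\<in>{j\<in>jobs I. release I j \<le> T}. f (E j + ?d j) - f (E j))"
    using assms(1-3) by (intro sum.mono_neutral_cong_left) auto
  moreover have "f (D T) = f 0 + (\<Sum>t\<in>{a..<T}. f (D t + ?g t) - f (D t))
      + (\<Sum>j\<in>{j\<in>jobs I. release I j \<le> T}. f (E j + ?d j) - f (E j))"
    unfolding D E by (rule arrival_telescope[OF assms(1) a])
  ultimately show ?thesis
    by (simp add: algebra_simps)
qed

section \<open>Weighted sums over density classes\<close>

lemma class_sum_swap:
  fixes q :: "nat \<Rightarrow> real" and K :: "int set"
  assumes "finite K" "finite X"
  shows "(\<Sum>k\<in>K. 2 powi k * (\<Sum>i\<in>{i\<in>X. k \<le> c i}. q i)) =
    (\<Sum>i\<in>X. (\<Sum>k\<in>{k\<in>K. k \<le> c i}. 2 powi k) * q i)"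
  using sum.swap_restrict[OF assms, of "\<lambda>k i. 2 powi k * q i" "\<lambda>k i. k \<le> c i"]
  by (simp add: sum_distrib_left sum_distrib_right)

text \<open>After the swap, each \<open>i\<close> carries a geometric sum with exponents up to
  \<open>min m (c i)\<close>.\<close>

lemma class_sum_le:
  fixes q :: "nat \<Rightarrow> real" and K :: "int set"
  assumes "finite K" "finite X" "\<And>i. i \<in> X \<Longrightarrow> 0 \<le> q i" "\<And>k. k \<in> K \<Longrightarrow> k \<le> m"
  shows "(\<Sum>k\<in>K. 2 powi k * (\<Sum>i\<in>{i\<in>X. k \<le> c i}. q i))
    \<le> (\<Sum>i\<in>X. 2 * 2 powi min m (c i) * q i)"
proof -
  have "(\<Sum>k\<in>{k\<in>K. k \<le> c i}. 2 powi k) \<le> 2 / (2 - 1) * (2::real) powi (min m (c i))" for i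
    using assms by (intro sum_powi_le) auto
  then show ?thesis
    unfolding class_sum_swap[OF assms(1,2)] using assms(3) by (intro sum_mono mult_right_mono) auto
qed

text \<open>After the swap, it suffices to keep the term \<open>k = h i\<close> for each
  \<open>i\<close>.\<close>

lemma class_sum_ge:
  fixes q :: "nat \<Rightarrow> real" and K :: "int set"
  assumes "finite K" "finite X" "\<And>i. i \<in> X \<Longrightarrow> 0 \<le> q i" "\<And>i. i \<in> X \<Longrightarrow> h i \<in> K \<and> h i \<le> c i"
  shows "(\<Sum>i\<in>X. 2 powi h i * q i) \<le> (\<Sum>k\<in>K. 2 powi k * (\<Sum>i\<in>{i\<in>X. k \<le> c i}. q i))"
proof -
  have "2 powi h i \<le> (\<Sum>k\<in>{k\<in>K. k \<le> c i}. 2 powi k :: real)" if "i \<in> X" for i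
    using assms(1) assms(4)[OF that] by (intro member_le_sum) auto
  then show ?thesis
    unfolding class_sum_swap[OF assms(1,2)] using assms(3) by (intro sum_mono mult_right_mono) auto
qed

subsection \<open>Runs of the algorithm\<close>

text \<open>Everything takes place in a finite window that opens before all releases and closes
  after \<open>Q\<close> has finished. The run may still be unfinished at \<open>T\<close>; its full
  flow-time is reached later by letting \<open>T\<close> grow.\<close>

locale run_analysis =
  fixes I :: job_instance and \<epsilon> :: real and S :: "int \<Rightarrow> nat option" and R :: "nat set"
    and Q :: schedule and a T :: int
  assumes finite_jobs: "finite (jobs I)"
    and proc_pos: "j \<in> jobs I \<Longrightarrow> 0 < proc I j"
    and weight_pos: "j \<in> jobs I \<Longrightarrow> 0 < weight I j"
    and eps_pos: "0 < \<epsilon>" and eps_le: "\<epsilon> \<le> 1" and inverse_eps_Ints: "1 / \<epsilon> \<in> \<int>"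
    and run: "algorithm_run I \<epsilon> S R"
    and feasible: "feasible_schedule I Q"
    and start: "j \<in> jobs I \<Longrightarrow> a < release I j"
    and horizon: "a \<le> T" "j \<in> jobs I \<Longrightarrow> release I j \<le> T"
    and finished: "j \<in> jobs I \<Longrightarrow> remaining I Q j T = 0"
begin

abbreviation "A \<equiv> slot_schedule S"
abbreviation "cls j \<equiv> floor2 (density I j)"
abbreviation "p j \<equiv> real (proc I j)"

definition "K = cls ` jobs I"

lemma finite_K: "finite K"
  using finite_jobs by (simp add: K_def)

lemma density_pos: "j \<in> jobs I \<Longrightarrow> 0 < density I j"
  using proc_pos weight_pos by (simp add: density_def)

lemma weight_nonneg: "j \<in> jobs I \<Longrightarrow> 0 \<le> weight I j"
  using weight_pos by (simp add: less_imp_le)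

lemma weight_eq: "j \<in> jobs I \<Longrightarrow> weight I j = density I j * p j"
  using proc_pos[of j] by (simp add: density_def)

lemma cls_le: "j \<in> jobs I \<Longrightarrow> 2 powi cls j \<le> density I j"
  and cls_gt: "j \<in> jobs I \<Longrightarrow> density I j < 2 * 2 powi cls j"
  using floor2_bounds density_pos by blast+

lemma density_less_of_cls: "i \<in> jobs I \<Longrightarrow> j \<in> jobs I \<Longrightarrow> cls j < cls i \<Longrightarrow> density I j < density I i"
  using floor2_mono[OF density_pos, of i "density I j"] by (metis linorder_not_less)

lemma R_subset: "R \<subseteq> jobs I"
  using run by (auto simp: algorithm_run_def)

lemma run_slot:
  "if \<exists>j \<in> active I S R t - preemptible I \<epsilon> S t. S (t - 1) = Some j
   then S t = S (t - 1)
   else if active I S R t = {} then S t = None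
   else \<exists>j \<in> active I S R t. S t = Some j \<and> (\<forall>i \<in> active I S R t. density I i \<le> density I j)"
  using run unfolding algorithm_run_def by (elim conjE allE[of _ t])

lemma run_active: "S t = Some j \<Longrightarrow> j \<in> active I S R t"
  using run_slot[of t] by (auto split: if_splits)

lemma run_continue:
  "S (t - 1) = Some j \<Longrightarrow> j \<in> active I S R t \<Longrightarrow> j \<notin> preemptible I \<epsilon> S t \<Longrightarrow> S t = Some j"
  using run_slot[of t] by (auto split: if_splits)

lemma run_choose:
  "S t = Some j \<Longrightarrow> S (t - 1) \<noteq> Some j \<or> j \<in> preemptible I \<epsilon> S t \<Longrightarrow> i \<in> active I S R t
    \<Longrightarrow> density I i \<le> density I j"
  using run_slot[of t] by (auto split: if_splits)

lemma run_idle: "S t = None \<Longrightarrow> active I S R t = {}"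
  using run_slot[of t] by (auto split: if_splits)

lemma A_cases: "A t j = (if S t = Some j then 1 else 0)"
  by (simp add: slot_schedule_def)

lemma A_support: "A t j \<noteq> 0 \<Longrightarrow> j \<in> jobs I - R \<and> release I j \<le> t"
  using run_active[of t j] by (auto simp: A_cases active_def split: if_splits)

lemma respects_A: "respects_releases I A"
  using A_support by (force simp: respects_releases_def)

lemma remaining_A_Ints: "remaining I A j t \<in> \<int>"
  unfolding remaining_def by (intro Ints_diff Ints_sum) (auto simp: A_cases)

lemma remaining_A_ge_1: "0 < remaining I A j t \<Longrightarrow> 1 \<le> remaining I A j t"
  using remaining_A_Ints[of j t] by (auto simp: Ints_def)

lemma remaining_antimono:
  assumes "\<And>s. 0 \<le> y s j" "s \<le> t"
  shows "remaining I y j t \<le> remaining I y j s"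
  unfolding remaining_def using assms by (intro diff_left_mono sum_mono2) auto

lemma A_nonneg: "0 \<le> A s j"
  by (simp add: A_cases)

text \<open>Only active jobs are run, and their remaining times are positive integers, so a unit
  slot cannot overshoot.\<close>

lemma remaining_A_nonneg:
  assumes "j \<in> jobs I"
  shows "0 \<le> remaining I A j t"
proof (cases "release I j \<le> t")
  case True
  then show ?thesis
  proof (induction t rule: int_ge_induct)
    case base
    then show ?case by (simp add: remaining_def)
  next
    case (step t)
    show ?case
    proof (cases "S t = Some j")
      case True
      then have "1 \<le> remaining I A j t"
        using run_active[of t j] remaining_A_ge_1[of j t] by (simp add: active_def)
      then show ?thesis
        using remaining_step[OF respects_A assms, of t] True A_cases[of t j] by simp
    next
      case False
      then show ?thesis
        using step.IH remaining_step[OF respects_A assms, of t] A_cases[of t j] by simp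
    qed
  qed
qed (simp add: remaining_def)

lemma slots_le: "j \<in> jobs I \<Longrightarrow> (\<Sum>t\<in>{a..<T}. A t j) \<le> p j"
proof -
  assume j: "j \<in> jobs I"
  have "(\<Sum>t\<in>{a..<T}. A t j) = (\<Sum>t\<in>{release I j..<T}. A t j)"
    using start[OF j] A_support by (intro sum.mono_neutral_right) force+
  then show ?thesis
    using remaining_A_nonneg[OF j, of T] by (simp add: remaining_def)
qed

text \<open>A job outside the preemptible set has run without interruption since it was chosen as a
  densest job, so the denser active jobs have all arrived since then.\<close>

lemma denser_weight_le:
  assumes j: "S t = Some j"
  shows "(\<Sum>i\<in>{i\<in>active I S R t. density I j < density I i}. remaining_weight I A i t) \<le> weight I j / \<epsilon>"
proof (cases "S (t - 1) \<noteq> Some j \<or> j \<in> preemptible I \<epsilon> S t")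
  case True
  then have empty: "{i\<in>active I S R t. density I j < density I i} = {}"
    using run_choose[OF j] by force
  have "j \<in> jobs I" using run_active[OF j] by (simp add: active_def)
  then show ?thesis unfolding empty using weight_pos[of j] eps_pos by simp
next
  case False
  have jA: "j \<in> active I S R t" by (rule run_active[OF j])
  then have jJ: "j \<in> jobs I" by (simp add: active_def)
  define start_times where "start_times = {u\<in>{release I j..t}. S u = Some j}"
  have rel: "release I j \<le> u" if "S u = Some j" for u
    using run_active[OF that] by (simp add: active_def)
  have "t \<in> start_times" "start_times \<subseteq> {release I j..t}"
    using j rel by (auto simp: start_times_def)
  then have "finite start_times"
    using finite_subset by blast
  \<comment> \<open>The first slot of \<open>j\<close>. As \<open>preemptible\<close> only grows
    with time, \<open>j\<close> was outside it throughout, so \<open>run_continue\<close> keeps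
    \<open>j\<close> running from \<open>t'\<close> to \<open>t\<close>.\<close>
  define t' where "t' = Min start_times"
  have t': "S t' = Some j" "t' \<le> t" "\<And>u. u < t' \<Longrightarrow> S u \<noteq> Some j"
  proof -
    have "t' \<in> start_times"
      unfolding t'_def using \<open>finite start_times\<close> \<open>t \<in> start_times\<close> by (intro Min_in) auto
    then show "S t' = Some j" "t' \<le> t" by (auto simp: start_times_def)
    fix u assume "u < t'"
    moreover have "t' \<le> u" if "u \<in> start_times"
      unfolding t'_def using \<open>finite start_times\<close> that by simp
    ultimately show "S u \<noteq> Some j"
      using rel[of u] \<open>t' \<le> t\<close> by (auto simp: start_times_def)
  qed
  have "S (t - 1) = Some j" using False by simp
  then have "t' < t" using t'(3)[of "t - 1"] by force
  have act: "j \<in> active I S R u" if "t' \<le> u" "u \<le> t" for u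
  proof -
    have "remaining I A j t \<le> remaining I A j u"
      using that by (intro remaining_antimono A_nonneg)
    then show ?thesis
      using jA rel[OF t'(1)] that by (simp add: active_def)
  qed
  have pre: "j \<notin> preemptible I \<epsilon> S u" if "u \<le> t" for u
  proof
    assume "j \<in> preemptible I \<epsilon> S u"
    then have "j \<in> preemptible I \<epsilon> S t"
      unfolding preemptible_def mem_Collect_eq using that order_trans[OF _ that] by meson
    then show False using False by simp
  qed
  have cont: "S u = Some j" if "t' \<le> u" "u \<le> t" for u
    using that
  proof (induction u rule: int_ge_induct)
    case (step u)
    then have "S (u + 1 - 1) = Some j" "j \<in> active I S R (u + 1)" "j \<notin> preemptible I \<epsilon> S (u + 1)"
      using act[of "u + 1"] pre[of "u + 1"] by simp_all
    then show ?case by (rule run_continue)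
  qed (rule t'(1))
  have "(\<Sum>i\<in>{i\<in>jobs I. t' < release I i \<and> release I i \<le> t}. weight I i) \<le> weight I j / \<epsilon>"
  proof (rule ccontr)
    assume "\<not> ?thesis"
    then have "j \<in> preemptible I \<epsilon> S t"
      unfolding preemptible_def using \<open>t' < t\<close> t'(3) cont
      by (intro CollectI exI[of _ t] exI[of _ t'] conjI) auto
    then show False using False by simp
  qed
  moreover have "(\<Sum>i\<in>{i\<in>active I S R t. density I j < density I i}. remaining_weight I A i t)
      \<le> (\<Sum>i\<in>{i\<in>jobs I. t' < release I i \<and> release I i \<le> t}. weight I i)"
  proof -
    have "{i\<in>active I S R t. density I j < density I i} \<subseteq> {i\<in>jobs I. t' < release I i \<and> release I i \<le> t}"
    proof clarify
      fix i assume i: "i \<in> active I S R t" "density I j < density I i"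
      have "i \<notin> active I S R t'"
        using run_choose[OF t'(1), of i] t'(3)[of "t' - 1"] i(2) by auto
      then show "i \<in> jobs I \<and> t' < release I i \<and> release I i \<le> t"
        using i(1) remaining_antimono[of A i t' t, OF A_nonneg t'(2)]
        by (simp add: active_def)
    qed
    moreover have "remaining_weight I A i t \<le> weight I i" if "i \<in> jobs I" for i
    proof -
      have "remaining I A i t \<le> p i"
        unfolding remaining_def by (simp add: sum_nonneg A_nonneg)
      then show ?thesis
        using density_pos[OF that] by (simp add: remaining_weight_def weight_eq[OF that])
    qed
    ultimately show ?thesis
      using finite_jobs weight_nonneg
      by (intro order_trans[OF sum_mono sum_mono2]) (simp_all add: active_def)
  qed
  ultimately show ?thesis by linarith
qed

section \<open>Class volumes and flow-time in the window\<close>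

abbreviation "dense G k \<equiv> {i\<in>G. k \<le> cls i}"
abbreviation "volA k t \<equiv> vol I A (dense (jobs I - R) k) t"
abbreviation "volQ k t \<equiv> vol I Q (dense (jobs I) k) t"
abbreviation "arrA k j \<equiv> vol_before I A (dense (jobs I - R) k) j"
abbreviation "arrQ k j \<equiv> vol_before I Q (dense (jobs I) k) j"

definition "flow y G = (\<Sum>t\<in>{a..<T}. \<Sum>i\<in>{i\<in>G. release I i \<le> t}. remaining_weight I y i t)"

abbreviation "F \<equiv> flow Q (jobs I)"

lemma class_vol_eq:
  "vol I y (dense G k) t = (\<Sum>i\<in>dense {i\<in>G. release I i \<le> t} k. remaining I y i t)"
  unfolding vol_def by (intro sum.cong) auto

text \<open>The powers of two up to the class of a job add up to at most twice its density; together
  with \<open>class_vol_ge\<close> this converts between active weight and class volumes.\<close>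

lemma class_vol_le:
  assumes "G \<subseteq> jobs I" "\<And>i. i \<in> jobs I \<Longrightarrow> 0 \<le> remaining I y i t"
  shows "(\<Sum>k\<in>K. 2 powi k * vol I y (dense G k) t)
    \<le> 2 * (\<Sum>i\<in>{i\<in>G. release I i \<le> t}. remaining_weight I y i t)"
proof -
  have fin: "finite {i\<in>G. release I i \<le> t}"
    using assms(1) finite_jobs by (auto intro: finite_subset)
  have "(\<Sum>k\<in>K. 2 powi k * vol I y (dense G k) t)
      \<le> (\<Sum>i\<in>{i\<in>G. release I i \<le> t}. 2 * 2 powi min (Max K) (cls i) * remaining I y i t)"
    unfolding class_vol_eq using assms finite_K fin
    by (intro class_sum_le) auto
  also have "\<dots> \<le> (\<Sum>i\<in>{i\<in>G. release I i \<le> t}. 2 * remaining_weight I y i t)"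
  proof (rule sum_mono)
    fix i assume "i \<in> {i\<in>G. release I i \<le> t}"
    then have i: "i \<in> jobs I" using assms by blast
    have "2 powi min (Max K) (cls i) \<le> (2 powi cls i :: real)" by (intro power_int_increasing) auto
    also have "\<dots> \<le> density I i" by (rule cls_le[OF i])
    finally show "2 * 2 powi min (Max K) (cls i) * remaining I y i t \<le> 2 * remaining_weight I y i t"
      using assms(2)[OF i] by (simp add: remaining_weight_def mult_right_mono)
  qed
  finally show ?thesis by (simp add: sum_distrib_left)
qed

lemma class_vol_ge:
  assumes "G \<subseteq> jobs I" "\<And>i. i \<in> jobs I \<Longrightarrow> 0 \<le> remaining I y i t"
  shows "(\<Sum>i\<in>{i\<in>G. release I i \<le> t}. remaining_weight I y i t)
    \<le> 2 * (\<Sum>k\<in>K. 2 powi k * vol I y (dense G k) t)"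
proof -
  have fin: "finite {i\<in>G. release I i \<le> t}"
    using assms(1) finite_jobs by (auto intro: finite_subset)
  have "(\<Sum>i\<in>{i\<in>G. release I i \<le> t}. 2 powi cls i * remaining I y i t)
      \<le> (\<Sum>k\<in>K. 2 powi k * vol I y (dense G k) t)"
    unfolding class_vol_eq using assms finite_K fin
    by (intro class_sum_ge) (auto simp: K_def)
  moreover have "(\<Sum>i\<in>{i\<in>G. release I i \<le> t}. remaining_weight I y i t)
      \<le> (\<Sum>i\<in>{i\<in>G. release I i \<le> t}. 2 * (2 powi cls i * remaining I y i t))"
  proof (rule sum_mono)
    fix i assume "i \<in> {i\<in>G. release I i \<le> t}"
    then have i: "i \<in> jobs I" using assms by blast
    then show "remaining_weight I y i t \<le> 2 * (2 powi cls i * remaining I y i t)"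
      using assms(2)[OF i] less_imp_le[OF cls_gt[OF i]]
      by (simp add: remaining_weight_def mult_right_mono flip: mult.assoc)
  qed
  ultimately show ?thesis unfolding sum_distrib_left[symmetric] by linarith
qed

subsection \<open>The optimal schedule\<close>

abbreviation "rel_upto G t \<equiv> {i\<in>G. release I i \<le> t}"

lemma Q_nonneg: "0 \<le> Q s j"
  using feasible by (simp add: feasible_schedule_def)

lemma respects_Q: "respects_releases I Q"
  using feasible unfolding feasible_schedule_def respects_releases_def by (meson not_le)

lemma remaining_Q_nonneg: "j \<in> jobs I \<Longrightarrow> 0 \<le> remaining I Q j t"
  using feasible by (simp add: feasible_schedule_def)

lemma Q_slot_nonneg: "0 \<le> (\<Sum>i\<in>G. Q t i)"
  by (simp add: sum_nonneg Q_nonneg)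

lemma Q_slot_le: "G \<subseteq> jobs I \<Longrightarrow> (\<Sum>i\<in>G. Q t i) \<le> 1"
proof -
  assume "G \<subseteq> jobs I"
  then have "(\<Sum>i\<in>G. Q t i) \<le> (\<Sum>i\<in>jobs I. Q t i)"
    using finite_jobs by (intro sum_mono2) (auto simp: Q_nonneg)
  also have "\<dots> \<le> 1"
    using feasible by (simp add: feasible_schedule_def)
  finally show ?thesis .
qed

lemma finite_sub: "G \<subseteq> jobs I \<Longrightarrow> finite G"
  using finite_jobs finite_subset by blast

lemma vol_nonneg:
  "G \<subseteq> jobs I \<Longrightarrow> (\<And>i. i \<in> jobs I \<Longrightarrow> 0 \<le> remaining I y i t) \<Longrightarrow> 0 \<le> vol I y G t"
  unfolding vol_def by (intro sum_nonneg) auto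

lemma vol_before_nonneg:
  "G \<subseteq> jobs I \<Longrightarrow> (\<And>i t. i \<in> jobs I \<Longrightarrow> 0 \<le> remaining I y i t) \<Longrightarrow> 0 \<le> vol_before I y G j"
  unfolding vol_before_def by (intro sum_nonneg) auto

lemma vol_after_slot_nonneg:
  assumes "G \<subseteq> jobs I" "respects_releases I y" "\<And>i t. i \<in> jobs I \<Longrightarrow> 0 \<le> remaining I y i t"
  shows "0 \<le> vol I y G t - (\<Sum>i\<in>G. y t i)"
  unfolding vol_step[OF finite_sub[OF assms(1)] assms(1,2)]
  using assms(1,3) by (intro sum_nonneg) auto

lemma volQ_nonneg: "0 \<le> volQ k t"
  by (intro vol_nonneg remaining_Q_nonneg) auto

lemma arrQ_nonneg: "0 \<le> arrQ k j"
  by (intro vol_before_nonneg remaining_Q_nonneg) auto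

lemma volA_nonneg: "0 \<le> volA k t"
  by (intro vol_nonneg remaining_A_nonneg) auto

lemma arrA_nonneg: "0 \<le> arrA k j"
  by (intro vol_before_nonneg remaining_A_nonneg) auto

lemma rel_upto_T: "G \<subseteq> jobs I \<Longrightarrow> rel_upto G T = G"
  using horizon by auto

lemma volQ_T: "volQ k T = 0"
  unfolding vol_def using finished by (intro sum.neutral) auto

text \<open>Telescope the square of \<open>volQ\<close>, which is zero at both ends of the window:
  what the arrivals add must be removed by the slots, and a slot removes at most
  \<open>2 * volQ k t\<close>.\<close>

lemma Q_arrivals:
  "(\<Sum>j\<in>dense (jobs I) k. 2 * p j * arrQ k j + (p j)\<^sup>2) \<le> 2 * (\<Sum>t\<in>{a..<T}. volQ k t)"
proof -
  let ?o = "\<lambda>t. \<Sum>i\<in>dense (jobs I) k. Q t i"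
  have "0 = (\<Sum>t\<in>{a..<T}. (volQ k t - ?o t)\<^sup>2 - (volQ k t)\<^sup>2)
      + (\<Sum>j\<in>rel_upto (dense (jobs I) k) T. (arrQ k j + p j)\<^sup>2 - (arrQ k j)\<^sup>2)"
    using vol_telescope[OF finite_jobs _ respects_Q start horizon(1), of "dense (jobs I) k" "\<lambda>x. x\<^sup>2"]
    by (simp add: volQ_T)
  also have "rel_upto (dense (jobs I) k) T = dense (jobs I) k"
    by (rule rel_upto_T) auto
  also have "(\<Sum>j\<in>dense (jobs I) k. (arrQ k j + p j)\<^sup>2 - (arrQ k j)\<^sup>2)
      = (\<Sum>j\<in>dense (jobs I) k. 2 * p j * arrQ k j + (p j)\<^sup>2)"
    by (intro sum.cong refl) (simp add: power2_sum)
  finally have "(\<Sum>j\<in>dense (jobs I) k. 2 * p j * arrQ k j + (p j)\<^sup>2)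
      = (\<Sum>t\<in>{a..<T}. (volQ k t)\<^sup>2 - (volQ k t - ?o t)\<^sup>2)"
    by (simp add: sum_subtractf)
  also have "\<dots> \<le> (\<Sum>t\<in>{a..<T}. 2 * volQ k t)"
  proof (rule sum_mono)
    fix t
    have "0 \<le> ?o t" "?o t \<le> 1" using Q_slot_nonneg Q_slot_le by auto
    then have "volQ k t * ?o t \<le> volQ k t"
      using volQ_nonneg by (intro mult_left_le)
    moreover have "(volQ k t)\<^sup>2 - (volQ k t - ?o t)\<^sup>2 = 2 * (volQ k t * ?o t) - (?o t)\<^sup>2"
      by (simp add: power2_diff)
    ultimately show "(volQ k t)\<^sup>2 - (volQ k t - ?o t)\<^sup>2 \<le> 2 * volQ k t"
      using zero_le_power2[of "?o t"] by linarith
  qed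
  finally show ?thesis by (simp add: sum_distrib_left)
qed

text \<open>Slots only lower the square of \<open>volQ\<close>, so at any time it is at most the
  total increase by arrivals.\<close>

lemma volQ_power2_le:
  assumes "a \<le> t"
  shows "(volQ k t)\<^sup>2 \<le> 2 * (\<Sum>t\<in>{a..<T}. volQ k t)"
proof -
  let ?o = "\<lambda>t. \<Sum>i\<in>dense (jobs I) k. Q t i"
  have "(volQ k t)\<^sup>2 = (\<Sum>t\<in>{a..<t}. (volQ k t - ?o t)\<^sup>2 - (volQ k t)\<^sup>2)
      + (\<Sum>j\<in>rel_upto (dense (jobs I) k) t. (arrQ k j + p j)\<^sup>2 - (arrQ k j)\<^sup>2)"
    using vol_telescope[OF finite_jobs _ respects_Q start assms, of "dense (jobs I) k" "\<lambda>x. x\<^sup>2"]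
    by simp
  also have "\<dots> \<le> 0 + (\<Sum>j\<in>rel_upto (dense (jobs I) k) t. (arrQ k j + p j)\<^sup>2 - (arrQ k j)\<^sup>2)"
  proof (intro add_right_mono sum_nonpos)
    fix t
    show "(volQ k t - ?o t)\<^sup>2 - (volQ k t)\<^sup>2 \<le> 0"
      using vol_after_slot_nonneg[OF _ respects_Q remaining_Q_nonneg, of "dense (jobs I) k" t]
        Q_slot_nonneg[of t "dense (jobs I) k"] by (simp add: power_mono)
  qed
  also have "\<dots> = (\<Sum>j\<in>rel_upto (dense (jobs I) k) t. 2 * p j * arrQ k j + (p j)\<^sup>2)"
    by (simp add: power2_sum algebra_simps)
  also have "\<dots> \<le> (\<Sum>j\<in>dense (jobs I) k. 2 * p j * arrQ k j + (p j)\<^sup>2)"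
    using finite_jobs arrQ_nonneg by (intro sum_mono2) auto
  also note Q_arrivals
  finally show ?thesis .
qed

lemma volQ_sum_le: "(\<Sum>k\<in>K. 2 powi k * (2 * (\<Sum>t\<in>{a..<T}. volQ k t))) \<le> 4 * F"
proof -
  have "(\<Sum>k\<in>K. 2 powi k * (2 * (\<Sum>t\<in>{a..<T}. volQ k t)))
      = 2 * (\<Sum>t\<in>{a..<T}. \<Sum>k\<in>K. 2 powi k * volQ k t)"
    unfolding sum_distrib_left by (subst sum.swap) (simp add: algebra_simps)
  also have "(\<Sum>t\<in>{a..<T}. \<Sum>k\<in>K. 2 powi k * volQ k t)
      \<le> (\<Sum>t\<in>{a..<T}. 2 * (\<Sum>i\<in>rel_upto (jobs I) t. remaining_weight I Q i t))"
    by (intro sum_mono class_vol_le remaining_Q_nonneg) auto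
  also have "\<dots> = 2 * F" by (simp add: flow_def sum_distrib_left)
  finally show ?thesis by simp
qed

lemma sum_dense_swap:
  assumes "G \<subseteq> jobs I"
  shows "(\<Sum>k\<in>K. 2 powi k * (\<Sum>j\<in>dense G k. h k j))
    = (\<Sum>j\<in>G. \<Sum>k\<in>{k\<in>K. k \<le> cls j}. 2 powi k * (h k j :: real))"
  unfolding sum_distrib_left by (intro sum.swap_restrict finite_K finite_sub assms)

lemma Q_arrivals_sum:
  "(\<Sum>j\<in>jobs I. \<Sum>k\<in>{k\<in>K. k \<le> cls j}. 2 powi k * (2 * p j * arrQ k j + (p j)\<^sup>2)) \<le> 4 * F"
proof -
  have "(\<Sum>j\<in>jobs I. \<Sum>k\<in>{k\<in>K. k \<le> cls j}. 2 powi k * (2 * p j * arrQ k j + (p j)\<^sup>2))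
      = (\<Sum>k\<in>K. 2 powi k * (\<Sum>j\<in>dense (jobs I) k. 2 * p j * arrQ k j + (p j)\<^sup>2))"
    by (intro sum_dense_swap[symmetric]) simp
  also have "\<dots> \<le> (\<Sum>k\<in>K. 2 powi k * (2 * (\<Sum>t\<in>{a..<T}. volQ k t)))"
    by (intro sum_mono mult_left_mono Q_arrivals) simp
  finally show ?thesis using volQ_sum_le by linarith
qed

definition "wp = (\<Sum>j\<in>jobs I. weight I j * p j)"

lemma wp_nonneg: "0 \<le> wp"
  unfolding wp_def using weight_pos by (intro sum_nonneg) (simp add: less_imp_le)

text \<open>Only the terms \<open>(p j)\<^sup>2\<close> for the job's own class are needed from
  \<open>Q_arrivals_sum\<close>; the factor 2 between density and class turns \<open>4 * F\<close>
  into \<open>8 * F\<close>.\<close>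

lemma wp_le: "wp \<le> 8 * F"
proof -
  have "wp \<le> (\<Sum>j\<in>jobs I. 2 * (\<Sum>k\<in>{k\<in>K. k \<le> cls j}. 2 powi k * (2 * p j * arrQ k j + (p j)\<^sup>2)))"
    unfolding wp_def
  proof (rule sum_mono)
    fix j assume j: "j \<in> jobs I"
    have "weight I j * p j = density I j * (p j)\<^sup>2"
      by (simp add: weight_eq[OF j] power2_eq_square)
    also have "\<dots> \<le> 2 * (2 powi cls j * (p j)\<^sup>2)"
      unfolding mult.assoc[symmetric] using cls_gt[OF j] by (intro mult_right_mono) auto
    also have "2 powi cls j * (p j)\<^sup>2 \<le> 2 powi cls j * (2 * p j * arrQ (cls j) j + (p j)\<^sup>2)"
      using arrQ_nonneg by (intro mult_left_mono) auto
    also have "\<dots> \<le> (\<Sum>k\<in>{k\<in>K. k \<le> cls j}. 2 powi k * (2 * p j * arrQ k j + (p j)\<^sup>2))"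
      using j finite_K arrQ_nonneg by (intro member_le_sum) (auto simp: K_def)
    finally show "weight I j * p j \<le> 2 * (\<Sum>k\<in>{k\<in>K. k \<le> cls j}. 2 powi k * (2 * p j * arrQ k j + (p j)\<^sup>2))"
      by simp
  qed
  then show ?thesis
    using Q_arrivals_sum by (simp add: sum_distrib_left[symmetric])
qed

subsection \<open>Delays and the excess over the optimum\<close>

text \<open>Volume that waits while a less dense class occupies the machine: the price of not
  preempting.\<close>

definition "delayed k t = (if \<exists>j. S t = Some j \<and> cls j < k then volA k t else 0)"

lemma delayed_nonneg: "0 \<le> delayed k t"
  using volA_nonneg[of k t] by (auto simp: delayed_def)

text \<open>Jobs of a higher class than \<open>j\<close> are strictly denser, so their weight is
  controlled by \<open>denser_weight_le\<close>; summing over classes costs a factor 2.\<close>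

lemma delayed_slot_le:
  assumes j: "S t = Some j"
  shows "(\<Sum>k\<in>K. 2 powi k * delayed k t) \<le> 2 * (weight I j / \<epsilon>)"
proof -
  let ?X = "{i\<in>rel_upto (jobs I - R) t. cls j < cls i}"
  have jJ: "j \<in> jobs I" using run_active[OF j] by (simp add: active_def)
  have fin: "finite ?X" using finite_jobs by simp
  have "(\<Sum>k\<in>K. 2 powi k * delayed k t)
      = (\<Sum>k\<in>{k\<in>K. cls j < k}. 2 powi k * (\<Sum>i\<in>dense ?X k. remaining I A i t))"
    using finite_K
  proof (intro sum.mono_neutral_cong_right ballI)
    fix k assume "k \<in> {k\<in>K. cls j < k}"
    then have "dense (rel_upto (jobs I - R) t) k = dense ?X k" "delayed k t = volA k t"
      using j by (auto simp: delayed_def)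
    then show "2 powi k * delayed k t = 2 powi k * (\<Sum>i\<in>dense ?X k. remaining I A i t)"
      by (simp only: class_vol_eq)
  qed (use j in \<open>auto simp: delayed_def\<close>)
  also have "\<dots> \<le> (\<Sum>i\<in>?X. 2 * 2 powi min (Max K) (cls i) * remaining I A i t)"
    using finite_K fin remaining_A_nonneg by (intro class_sum_le) auto
  also have "\<dots> \<le> (\<Sum>i\<in>?X. 2 * remaining_weight I A i t)"
  proof (rule sum_mono)
    fix i assume "i \<in> ?X"
    then have i: "i \<in> jobs I" by simp
    have "2 powi min (Max K) (cls i) \<le> (2 powi cls i :: real)"
      by (intro power_int_increasing) auto
    also have "\<dots> \<le> density I i" by (rule cls_le[OF i])
    finally show "2 * 2 powi min (Max K) (cls i) * remaining I A i t \<le> 2 * remaining_weight I A i t"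
      using remaining_A_nonneg[OF i] by (simp add: remaining_weight_def mult_right_mono)
  qed
  also have "\<dots> = 2 * (\<Sum>i\<in>?X. remaining_weight I A i t)"
    by (simp add: sum_distrib_left)
  also have "(\<Sum>i\<in>?X. remaining_weight I A i t)
      = (\<Sum>i\<in>{i\<in>?X. 0 < remaining I A i t}. remaining_weight I A i t)"
    using fin
  proof (intro sum.mono_neutral_right ballI)
    fix i assume "i \<in> ?X - {i\<in>?X. 0 < remaining I A i t}"
    then have "i \<in> jobs I" "\<not> 0 < remaining I A i t" by blast+
    then show "remaining_weight I A i t = 0"
      using remaining_A_nonneg[of i t] by (simp add: remaining_weight_def)
  qed auto
  also have "\<dots> \<le> (\<Sum>i\<in>{i\<in>active I S R t. density I j < density I i}. remaining_weight I A i t)"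
    using finite_jobs jJ density_pos
    by (intro sum_mono2)
      (auto simp: active_def remaining_weight_def intro: density_less_of_cls less_imp_le)
  also note denser_weight_le[OF j]
  finally show ?thesis by simp
qed

text \<open>A job occupies at most \<open>p j\<close> slots and causes delays of at most
  \<open>2 * (weight I j / \<epsilon>)\<close> in each.\<close>

lemma delayed_total_le: "(\<Sum>k\<in>K. 2 powi k * (\<Sum>t\<in>{a..<T}. delayed k t)) \<le> 2 * wp / \<epsilon>"
proof -
  have slot: "(\<Sum>k\<in>K. 2 powi k * delayed k t) \<le> (\<Sum>j\<in>jobs I. A t j * (2 * (weight I j / \<epsilon>)))" for t
  proof (cases "S t")
    case None
    then show ?thesis by (simp add: delayed_def A_cases)
  next
    case (Some j)
    then have "j \<in> jobs I" using run_active by (simp add: active_def)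
    then have "(\<Sum>i\<in>jobs I. A t i * (2 * (weight I i / \<epsilon>))) = 2 * (weight I j / \<epsilon>)"
      using finite_jobs
      by (simp add: A_cases Some if_distrib[of "\<lambda>x. x * _"] sum_divide_distrib[symmetric] cong: if_cong)
    then show ?thesis using delayed_slot_le[OF Some] by simp
  qed
  have "(\<Sum>k\<in>K. 2 powi k * (\<Sum>t\<in>{a..<T}. delayed k t)) = (\<Sum>t\<in>{a..<T}. \<Sum>k\<in>K. 2 powi k * delayed k t)"
    unfolding sum_distrib_left by (rule sum.swap)
  also have "\<dots> \<le> (\<Sum>t\<in>{a..<T}. \<Sum>j\<in>jobs I. A t j * (2 * (weight I j / \<epsilon>)))"
    by (intro sum_mono slot)
  also have "\<dots> = (\<Sum>j\<in>jobs I. (\<Sum>t\<in>{a..<T}. A t j) * (2 * (weight I j / \<epsilon>)))"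
    unfolding sum_distrib_right by (rule sum.swap)
  also have "\<dots> \<le> (\<Sum>j\<in>jobs I. p j * (2 * (weight I j / \<epsilon>)))"
    using weight_pos eps_pos slots_le
    by (intro sum_mono mult_right_mono) (auto simp: less_imp_le)
  also have "\<dots> = 2 * wp / \<epsilon>"
    by (simp add: wp_def sum_distrib_left sum_divide_distrib algebra_simps)
  finally show ?thesis .
qed

lemma A_slot: "(\<Sum>i\<in>dense (jobs I - R) k. A t i) = (if \<exists>j. S t = Some j \<and> k \<le> cls j then 1 else 0)"
proof (cases "S t")
  case (Some j)
  then have "j \<in> jobs I - R" using run_active by (auto simp: active_def)
  then show ?thesis using Some finite_jobs by (auto simp: A_cases)
qed (simp add: A_cases)

lemma volA_idle: "S t = None \<Longrightarrow> volA k t = 0"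
proof -
  assume "S t = None"
  then have "\<not> 0 < remaining I A i t" if "i \<in> jobs I - R" "release I i \<le> t" for i
    using run_idle[of t] that by (auto simp: active_def)
  then have "remaining I A i t = 0" if "i \<in> jobs I - R" "release I i \<le> t" for i
    using remaining_A_nonneg[of i t] that by fastforce
  then show ?thesis
    unfolding vol_def by (intro sum.neutral) auto
qed

text \<open>Integrality lets the constant 1 that arises when squaring be absorbed into the volume
  itself.\<close>

lemma volA_zero_or_ge_1: "volA k t = 0 \<or> 1 \<le> volA k t"
proof -
  have "volA k t \<in> \<int>"
    unfolding vol_def by (intro Ints_sum remaining_A_Ints)
  then show ?thesis using volA_nonneg[of k t] by (auto elim!: Ints_cases)
qed

text \<open>The squared excess of the algorithm's volume over that of \<open>Q\<close> grows only in slots with delayed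
  volume.  An accepted arrival leaves it unchanged and a rejected one lowers it, so the delays
  bound both the excess and the cost that the rejected jobs would have caused.\<close>

lemma excess_potential:
  assumes U: "a \<le> U" "U \<le> T"
  shows "(max 0 (volA k U - volQ k U))\<^sup>2
      + (\<Sum>j\<in>rel_upto (dense R k) U. max 0 (2 * p j * (arrA k j - arrQ k j) - (p j)\<^sup>2))
    \<le> 3 * (\<Sum>t\<in>{a..<T}. delayed k t)"
proof -
  define f where "f x = (max 0 x)\<^sup>2" for x :: real
  define D where "D t = volA k t - volQ k t" for t
  define E where "E j = arrA k j - arrQ k j" for j
  define u where "u t = (\<Sum>i\<in>dense (jobs I - R) k. A t i)" for t
  define v where "v t = (\<Sum>i\<in>dense (jobs I) k. Q t i)" for t
  have f_mono: "f x \<le> f y" if "x \<le> y" for x y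
    unfolding f_def using that by (intro power_mono) auto
  have sub: "dense (jobs I - R) k \<subseteq> dense (jobs I) k" "dense (jobs I) k \<subseteq> jobs I" by auto
  have diff: "dense (jobs I) k - dense (jobs I - R) k = dense R k"
    using R_subset by auto
  have tele: "f (D U) = f 0 + (\<Sum>t\<in>{a..<U}. f (D t - (u t - v t)) - f (D t))
      + (\<Sum>j\<in>rel_upto (dense R k) U. f (E j - p j) - f (E j))"
    using vol_diff_telescope[OF finite_jobs sub respects_A respects_Q start U(1), of f]
    by (simp only: diff D_def E_def u_def v_def)
  have u_eq: "u t = (if \<exists>j. S t = Some j \<and> k \<le> cls j then 1 else 0)" for t
    unfolding u_def by (rule A_slot)
  \<comment> \<open>The excess can rise only if the run does not serve these classes, and then by at
    most 1. If volume is waiting, the square gains at most \<open>2 * max 0 (D t) + 1\<close>, hence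
    at most three times that volume; if none is waiting, no positive excess can result.\<close>
  have slot: "f (D t - (u t - v t)) - f (D t) \<le> 3 * delayed k t" for t
  proof -
    have v: "0 \<le> v t" "v t \<le> 1"
      unfolding v_def using Q_slot_nonneg Q_slot_le sub(2) by auto
    have after: "D t - (u t - v t) \<le> volA k t - u t"
      using vol_after_slot_nonneg[OF sub(2) respects_Q remaining_Q_nonneg, of t]
      by (simp add: D_def v_def)
    show ?thesis
    proof (cases "u t = 0")
      case False
      then have "u t = 1" by (auto simp: u_eq split: if_splits)
      then have "f (D t - (u t - v t)) \<le> f (D t)" using v by (intro f_mono) auto
      then show ?thesis using delayed_nonneg[of k t] by linarith
    next
      case True
      show ?thesis
      proof (cases "volA k t = 0")
        case True
        then have "f (D t - (u t - v t)) = 0"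
          using after \<open>u t = 0\<close> by (simp add: f_def)
        moreover have "0 \<le> f (D t)" by (simp add: f_def)
        ultimately show ?thesis using delayed_nonneg[of k t] by linarith
      next
        case False
        then have ge: "1 \<le> volA k t" using volA_zero_or_ge_1 by blast
        obtain j where "S t = Some j" using False volA_idle by blast
        then have del: "delayed k t = volA k t"
          using \<open>u t = 0\<close> by (auto simp: u_eq delayed_def split: if_splits)
        have "max 0 (D t) \<le> volA k t"
          using volQ_nonneg[of k t] ge by (auto simp: D_def)
        moreover have "f (D t - (u t - v t)) \<le> (max 0 (D t) + 1)\<^sup>2"
          unfolding f_def using v True by (intro power_mono) auto
        moreover have "(max 0 (D t) + 1)\<^sup>2 = f (D t) + 2 * max 0 (D t) + 1"
          by (simp add: f_def power2_sum)
        ultimately show ?thesis using ge del by linarith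
      qed
    qed
  qed
  \<comment> \<open>Dropping the truncation gives the exact change of a square if
    \<open>0 \<le> E j\<close>; otherwise the claimed decrease is zero and monotonicity of
    \<open>f\<close> suffices.\<close>
  have arrival: "f (E j - p j) - f (E j) \<le> - max 0 (2 * p j * E j - (p j)\<^sup>2)" for j
  proof (cases "0 \<le> E j")
    case True
    have "f (E j - p j) \<le> (E j - p j)\<^sup>2"
      unfolding f_def by (auto simp: max_def)
    also have "\<dots> = f (E j) - (2 * p j * E j - (p j)\<^sup>2)"
      using True by (simp add: f_def power2_diff)
    finally show ?thesis using f_mono[of "E j - p j" "E j"] by simp
  next
    case False
    then have "2 * p j * E j \<le> 0" by (simp add: mult_nonneg_nonpos)
    then have "max 0 (2 * p j * E j - (p j)\<^sup>2) = 0"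
      using zero_le_power2[of "p j"] by linarith
    then show ?thesis using f_mono[of "E j - p j" "E j"] by simp
  qed
  have "f (D U) \<le> 0 + (\<Sum>t\<in>{a..<U}. 3 * delayed k t)
      + (\<Sum>j\<in>rel_upto (dense R k) U. - max 0 (2 * p j * E j - (p j)\<^sup>2))"
    unfolding tele by (intro add_mono sum_mono slot arrival) (simp add: f_def)
  moreover have "(\<Sum>t\<in>{a..<U}. 3 * delayed k t) \<le> (\<Sum>t\<in>{a..<T}. 3 * delayed k t)"
    using U(2) delayed_nonneg by (intro sum_mono2) auto
  ultimately show ?thesis
    by (simp add: f_def D_def E_def sum_negf sum_distrib_left)
qed

text \<open>Telescope the square of \<open>volA\<close>. A slot serving these classes lowers it by
  \<open>2 * volA k t - 1\<close>, which is at least \<open>volA k t\<close> since the volume served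
  is at least 1; any other slot is idle with no volume, or fully accounted for by
  \<open>delayed\<close>.\<close>

lemma volA_sum_le:
  "(\<Sum>t\<in>{a..<T}. volA k t) \<le> (\<Sum>t\<in>{a..<T}. delayed k t)
    + (\<Sum>j\<in>dense (jobs I - R) k. 2 * p j * arrA k j + (p j)\<^sup>2)"
proof -
  let ?G = "dense (jobs I - R) k"
  let ?u = "\<lambda>t. \<Sum>i\<in>?G. A t i"
  have G: "?G \<subseteq> jobs I" by auto
  have "(volA k T)\<^sup>2 = (\<Sum>t\<in>{a..<T}. (volA k t - ?u t)\<^sup>2 - (volA k t)\<^sup>2)
      + (\<Sum>j\<in>rel_upto ?G T. (arrA k j + p j)\<^sup>2 - (arrA k j)\<^sup>2)"
    using vol_telescope[OF finite_jobs G respects_A start horizon(1), of "\<lambda>x. x\<^sup>2"]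
    by simp
  also have "\<dots> \<le> (\<Sum>t\<in>{a..<T}. delayed k t - volA k t)
      + (\<Sum>j\<in>rel_upto ?G T. (arrA k j + p j)\<^sup>2 - (arrA k j)\<^sup>2)"
  proof (intro add_right_mono sum_mono)
    fix t
    consider "?u t = 1" | "?u t = 0" "S t = None" | "?u t = 0" "delayed k t = volA k t"
    proof (cases "S t")
      case (Some j)
      show ?thesis
      proof (cases "k \<le> cls j")
        case True
        then have "?u t = 1" unfolding A_slot using Some by auto
        then show ?thesis by (rule that(1))
      next
        case False
        then have "?u t = 0" "delayed k t = volA k t"
          unfolding A_slot delayed_def using Some by auto
        then show ?thesis by (rule that(3))
      qed
    qed (use that(2) A_slot[of t k] in simp)
    then show "(volA k t - ?u t)\<^sup>2 - (volA k t)\<^sup>2 \<le> delayed k t - volA k t"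
    proof cases
      case 1
      have "0 \<le> volA k t - ?u t"
        by (rule vol_after_slot_nonneg[OF G respects_A remaining_A_nonneg])
      then have "1 \<le> volA k t" using 1 by simp
      moreover have "(volA k t - ?u t)\<^sup>2 - (volA k t)\<^sup>2 = 1 - 2 * volA k t"
        unfolding 1 by (simp add: power2_diff)
      ultimately show ?thesis using delayed_nonneg[of k t] by linarith
    next
      case 2
      then show ?thesis using volA_idle[OF 2(2), of k] delayed_nonneg[of k t] by simp
    next
      case 3
      then show ?thesis by simp
    qed
  qed
  also have "rel_upto ?G T = ?G" by (rule rel_upto_T[OF G])
  also have "(\<Sum>j\<in>?G. (arrA k j + p j)\<^sup>2 - (arrA k j)\<^sup>2) = (\<Sum>j\<in>?G. 2 * p j * arrA k j + (p j)\<^sup>2)"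
    by (intro sum.cong refl) (simp add: power2_sum)
  finally show ?thesis
    unfolding sum_subtractf using zero_le_power2[of "volA k T"] by linarith
qed

subsection \<open>Costs of arrivals\<close>

abbreviation "alphap \<equiv> alpha_plus I S R"
abbreviation "alpham \<equiv> alpha_minus I S R"
abbreviation "earlier j \<equiv> {i\<in>jobs I - R. before I i j}"

lemma finite_active: "finite (active I S R t)"
  using finite_jobs by (simp add: active_def)

lemma active_on_arrival_eq:
  "active_on_arrival I S R j = {i\<in>earlier j. 0 < remaining I A i (release I j)}"
  by (auto simp: active_on_arrival_def active_def before_def)

text \<open>Splitting into \<open>D_plus\<close> and \<open>D_minus\<close> matters only for the
  buckets. In the sum of both parts, each earlier job and \<open>j\<close> delay one another at the
  rate of the smaller density.\<close>

lemma alpha_eq: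
  assumes "j \<in> jobs I"
  shows "alphap j + alpham j = p j * (\<Sum>i\<in>earlier j. min (density I i) (density I j) * remaining I A i (release I j))"
proof -
  let ?X = "active_on_arrival I S R j" and ?D = "D_plus I S R j"
  let ?q = "\<lambda>i. remaining I A i (release I j)"
  let ?m = "\<lambda>i. min (density I i) (density I j) * ?q i"
  have fin: "finite ?X"
    using finite_active by (simp add: active_on_arrival_def)
  have D: "?D \<subseteq> ?X" "finite ?D"
    using fin by (auto simp: D_plus_def)
  have "(\<Sum>i\<in>earlier j. ?m i) = (\<Sum>i\<in>?X. ?m i)"
    using finite_jobs remaining_A_nonneg unfolding active_on_arrival_eq
    by (intro sum.mono_neutral_right) (auto simp: order.order_iff_strict)
  also have "\<dots> = (\<Sum>i\<in>D_minus I S R j. ?m i) + (\<Sum>i\<in>?D. ?m i)"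
    unfolding D_minus_def by (rule sum.subset_diff[OF D(1) fin])
  also have "(\<Sum>i\<in>?D. ?m i) = (\<Sum>i\<in>{i\<in>?D. density I i \<ge> density I j} \<union> {i\<in>?D. density I i < density I j}. ?m i)"
    by (intro sum.cong) auto
  also have "\<dots> = (\<Sum>i\<in>{i\<in>?D. density I i \<ge> density I j}. ?m i) + (\<Sum>i\<in>{i\<in>?D. density I i < density I j}. ?m i)"
    using D(2) by (intro sum.union_disjoint) auto
  also have "(\<Sum>i\<in>{i\<in>?D. density I i \<ge> density I j}. ?m i) = (\<Sum>i\<in>{i\<in>?D. density I i \<ge> density I j}. density I j * ?q i)"
    by (intro sum.cong) auto
  also have "(\<Sum>i\<in>{i\<in>?D. density I i < density I j}. ?m i) = (\<Sum>i\<in>{i\<in>?D. density I i < density I j}. remaining_weight I A i (release I j))"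
    by (intro sum.cong) (auto simp: remaining_weight_def)
  also have "(\<Sum>i\<in>D_minus I S R j. ?m i) = (\<Sum>i\<in>D_minus I S R j. remaining_weight I A i (release I j))"
  proof (intro sum.cong refl)
    fix i assume "i \<in> D_minus I S R j"
    then have "i \<in> jobs I" "cls i < cls j"
      by (auto simp: D_minus_def D_plus_def active_on_arrival_def active_def)
    then show "?m i = remaining_weight I A i (release I j)"
      using density_less_of_cls[OF assms, of i] by (simp add: remaining_weight_def)
  qed
  finally show ?thesis
    by (simp add: alpha_plus_def alpha_minus_def weight_eq[OF assms] sum_distrib_left[symmetric] algebra_simps)
qed

lemma min_density_bounds:
  assumes "i \<in> jobs I" "j \<in> jobs I"
  shows "2 powi min (cls j) (cls i) \<le> min (density I i) (density I j)"
    "min (density I i) (density I j) \<le> 2 * 2 powi min (cls j) (cls i)"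
proof -
  have "2 powi min (cls j) (cls i) \<le> (2 powi cls i :: real)" "2 powi min (cls j) (cls i) \<le> (2 powi cls j :: real)"
    by (auto intro!: power_int_increasing)
  then show "2 powi min (cls j) (cls i) \<le> min (density I i) (density I j)"
    using cls_le[OF assms(1)] cls_le[OF assms(2)] by linarith
  show "min (density I i) (density I j) \<le> 2 * 2 powi min (cls j) (cls i)"
    using cls_gt[OF assms(1)] cls_gt[OF assms(2)] by (auto simp: min_def)
qed

text \<open>The class form of the sum in \<open>alpha_eq\<close>: classes up to that of
  \<open>j\<close> see job \<open>i\<close> with total factor about
  \<open>2 powi min (cls j) (cls i)\<close>.\<close>

definition "class_arr j = (\<Sum>k\<in>{k\<in>K. k \<le> cls j}. 2 powi k * arrA k j)"

lemma arrA_eq: "arrA k j = (\<Sum>i\<in>dense (earlier j) k. remaining I A i (release I j))"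
  unfolding vol_before_def by (intro sum.cong) auto

lemma class_arr_le:
  assumes "j \<in> jobs I"
  shows "p j * class_arr j \<le> 2 * (alphap j + alpham j)"
proof -
  have "class_arr j \<le> (\<Sum>i\<in>earlier j. 2 * 2 powi min (cls j) (cls i) * remaining I A i (release I j))"
    unfolding class_arr_def arrA_eq using finite_K finite_jobs remaining_A_nonneg
    by (intro class_sum_le) auto
  also have "\<dots> \<le> (\<Sum>i\<in>earlier j. 2 * (min (density I i) (density I j) * remaining I A i (release I j)))"
    using remaining_A_nonneg min_density_bounds(1)[OF _ assms]
    unfolding mult.assoc by (intro sum_mono mult_left_mono mult_right_mono) auto
  finally have "class_arr j \<le> 2 * (\<Sum>i\<in>earlier j. min (density I i) (density I j) * remaining I A i (release I j))"
    unfolding sum_distrib_left .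
  from mult_left_mono[OF this, of "p j"] show ?thesis
    by (simp add: alpha_eq[OF assms])
qed

lemma class_arr_ge:
  assumes "j \<in> jobs I"
  shows "alphap j + alpham j \<le> 2 * (p j * class_arr j)"
proof -
  have "(\<Sum>i\<in>earlier j. min (density I i) (density I j) * remaining I A i (release I j))
      \<le> (\<Sum>i\<in>earlier j. 2 * (2 powi min (cls j) (cls i) * remaining I A i (release I j)))"
    using remaining_A_nonneg min_density_bounds(2)[OF _ assms]
    unfolding mult.assoc[symmetric] by (intro sum_mono mult_right_mono) auto
  also have "\<dots> \<le> 2 * class_arr j"
    unfolding class_arr_def arrA_eq sum_distrib_left[symmetric]
    using finite_K finite_jobs remaining_A_nonneg assms
    by (intro mult_left_mono class_sum_ge) (auto simp: K_def min_def)
  finally have "p j * (\<Sum>i\<in>earlier j. min (density I i) (density I j) * remaining I A i (release I j))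
      \<le> p j * (2 * class_arr j)"
    by (rule mult_left_mono) simp
  then show ?thesis
    by (simp add: alpha_eq[OF assms])
qed

text \<open>The cost of a rejected job is its insertion cost in \<open>Q\<close> plus the drop it
  causes in the excess potential. The former is bounded by \<open>Q_arrivals_sum\<close>, the latter
  by the delays.\<close>

lemma alpha_rejected_le: "(\<Sum>j\<in>R. alphap j + alpham j) \<le> 4 * F + 6 * wp / \<epsilon>"
proof -
  let ?u = "\<lambda>k j. 2 * p j * arrQ k j + (p j)\<^sup>2"
  let ?e = "\<lambda>k j. max 0 (2 * p j * (arrA k j - arrQ k j) - (p j)\<^sup>2)"
  have finR: "finite R" using finite_sub[OF R_subset] .
  have "(\<Sum>j\<in>R. alphap j + alpham j) \<le> (\<Sum>j\<in>R. 2 * (p j * class_arr j))"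
    using R_subset by (intro sum_mono class_arr_ge) auto
  also have "\<dots> = (\<Sum>j\<in>R. \<Sum>k\<in>{k\<in>K. k \<le> cls j}. 2 powi k * (2 * p j * arrA k j))"
    by (simp add: class_arr_def sum_distrib_left algebra_simps)
  \<comment> \<open>Without the maximum, \<open>?u k j + ?e k j\<close> is exactly
    \<open>2 * p j * arrA k j\<close>.\<close>
  also have "\<dots> \<le> (\<Sum>j\<in>R. \<Sum>k\<in>{k\<in>K. k \<le> cls j}. 2 powi k * (?u k j + ?e k j))"
    by (intro sum_mono mult_left_mono) (auto simp: algebra_simps)
  also have "\<dots> = (\<Sum>j\<in>R. \<Sum>k\<in>{k\<in>K. k \<le> cls j}. 2 powi k * ?u k j)
      + (\<Sum>j\<in>R. \<Sum>k\<in>{k\<in>K. k \<le> cls j}. 2 powi k * ?e k j)"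
    by (simp only: distrib_left sum.distrib)
  also have "\<dots> \<le> 4 * F + 6 * wp / \<epsilon>"
  proof (rule add_mono)
    have "(\<Sum>j\<in>R. \<Sum>k\<in>{k\<in>K. k \<le> cls j}. 2 powi k * ?u k j)
        \<le> (\<Sum>j\<in>jobs I. \<Sum>k\<in>{k\<in>K. k \<le> cls j}. 2 powi k * ?u k j)"
      using finite_jobs R_subset arrQ_nonneg by (intro sum_mono2 sum_nonneg) auto
    also note Q_arrivals_sum
    finally show "(\<Sum>j\<in>R. \<Sum>k\<in>{k\<in>K. k \<le> cls j}. 2 powi k * ?u k j) \<le> 4 * F" .
    have "(\<Sum>j\<in>R. \<Sum>k\<in>{k\<in>K. k \<le> cls j}. 2 powi k * ?e k j) = (\<Sum>k\<in>K. 2 powi k * (\<Sum>j\<in>dense R k. ?e k j))"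
      by (rule sum_dense_swap[OF R_subset, symmetric])
    also have "\<dots> \<le> (\<Sum>k\<in>K. 2 powi k * (3 * (\<Sum>t\<in>{a..<T}. delayed k t)))"
    proof (intro sum_mono mult_left_mono)
      fix k
      have "rel_upto (dense R k) T = dense R k"
        using R_subset by (intro rel_upto_T) auto
      then show "(\<Sum>j\<in>dense R k. ?e k j) \<le> 3 * (\<Sum>t\<in>{a..<T}. delayed k t)"
        using excess_potential[OF horizon(1) order_refl, of k]
          zero_le_power2[of "max 0 (volA k T - volQ k T)"] by (simp only:)
    qed simp
    also have "\<dots> = 3 * (\<Sum>k\<in>K. 2 powi k * (\<Sum>t\<in>{a..<T}. delayed k t))"
      by (simp add: sum_distrib_left algebra_simps)
    also have "\<dots> \<le> 3 * (2 * wp / \<epsilon>)"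
      by (intro mult_left_mono delayed_total_le) simp
    finally show "(\<Sum>j\<in>R. \<Sum>k\<in>{k\<in>K. k \<le> cls j}. 2 powi k * ?e k j) \<le> 6 * wp / \<epsilon>"
      by simp
  qed
  finally show ?thesis .
qed

lemma alphap_nonneg: "j \<in> jobs I \<Longrightarrow> 0 \<le> alphap j"
  unfolding alpha_plus_def using weight_nonneg density_pos remaining_A_nonneg
  by (intro add_nonneg_nonneg mult_nonneg_nonneg sum_nonneg)
    (auto simp: D_plus_def active_on_arrival_def active_def remaining_weight_def less_imp_le)

lemma alpham_nonneg: "j \<in> jobs I \<Longrightarrow> 0 \<le> alpham j"
  unfolding alpha_minus_def using density_pos remaining_A_nonneg
  by (intro mult_nonneg_nonneg sum_nonneg)
    (auto simp: D_minus_def active_on_arrival_def active_def remaining_weight_def less_imp_le)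

text \<open>Sum \<open>volA_sum_le\<close> over the classes: delays give
  \<open>wp / \<epsilon>\<close>, the mixed arrival terms give \<open>class_arr\<close> and hence
  the \<open>\<alpha>\<close> values, and the squares of processing times give
  \<open>wp\<close>.\<close>

lemma flow_A_le: "flow A (jobs I - R) \<le> 4 * wp / \<epsilon> + 4 * wp + 8 * (\<Sum>j\<in>jobs I. alphap j + alpham j)"
proof -
  let ?u = "\<lambda>k j. 2 * p j * arrA k j + (p j)\<^sup>2"
  have "flow A (jobs I - R) \<le> (\<Sum>t\<in>{a..<T}. 2 * (\<Sum>k\<in>K. 2 powi k * volA k t))"
    unfolding flow_def by (intro sum_mono class_vol_ge remaining_A_nonneg) auto
  also have "\<dots> = 2 * (\<Sum>k\<in>K. 2 powi k * (\<Sum>t\<in>{a..<T}. volA k t))"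
    unfolding sum_distrib_left by (rule sum.swap)
  also have "\<dots> \<le> 2 * (\<Sum>k\<in>K. 2 powi k * ((\<Sum>t\<in>{a..<T}. delayed k t) + (\<Sum>j\<in>dense (jobs I - R) k. ?u k j)))"
    by (intro mult_left_mono sum_mono volA_sum_le) auto
  also have "\<dots> = 2 * (\<Sum>k\<in>K. 2 powi k * (\<Sum>t\<in>{a..<T}. delayed k t))
      + 2 * (\<Sum>j\<in>jobs I - R. \<Sum>k\<in>{k\<in>K. k \<le> cls j}. 2 powi k * ?u k j)"
    unfolding sum_dense_swap[OF Diff_subset, symmetric] by (simp only: distrib_left sum.distrib)
  also have "\<dots> \<le> 2 * (2 * wp / \<epsilon>) + 2 * (\<Sum>j\<in>jobs I. 4 * (alphap j + alpham j) + 2 * (weight I j * p j))"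
  proof (intro add_mono mult_left_mono delayed_total_le)
    have "(\<Sum>j\<in>jobs I - R. \<Sum>k\<in>{k\<in>K. k \<le> cls j}. 2 powi k * ?u k j)
        \<le> (\<Sum>j\<in>jobs I. \<Sum>k\<in>{k\<in>K. k \<le> cls j}. 2 powi k * ?u k j)"
      using finite_jobs arrA_nonneg by (intro sum_mono2 sum_nonneg) auto
    also have "\<dots> \<le> (\<Sum>j\<in>jobs I. 4 * (alphap j + alpham j) + 2 * (weight I j * p j))"
    proof (rule sum_mono)
      fix j assume j: "j \<in> jobs I"
      have "(\<Sum>k\<in>{k\<in>K. k \<le> cls j}. 2 powi k) \<le> 2 / (2 - 1) * (2::real) powi cls j"
        using finite_K by (intro sum_powi_le) auto
      also have "\<dots> \<le> 2 * density I j" using cls_le[OF j] by simp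
      finally have "(\<Sum>k\<in>{k\<in>K. k \<le> cls j}. 2 powi k) * (p j)\<^sup>2 \<le> 2 * density I j * (p j)\<^sup>2"
        by (rule mult_right_mono) simp
      also have "\<dots> = 2 * (weight I j * p j)"
        by (simp add: weight_eq[OF j] power2_eq_square)
      finally have "(\<Sum>k\<in>{k\<in>K. k \<le> cls j}. 2 powi k) * (p j)\<^sup>2 \<le> 2 * (weight I j * p j)" .
      moreover have "(\<Sum>k\<in>{k\<in>K. k \<le> cls j}. 2 powi k * ?u k j)
          = 2 * (p j * class_arr j) + (\<Sum>k\<in>{k\<in>K. k \<le> cls j}. 2 powi k) * (p j)\<^sup>2"
        by (simp add: class_arr_def distrib_left sum.distrib sum_distrib_left sum_distrib_right algebra_simps)
      ultimately show "(\<Sum>k\<in>{k\<in>K. k \<le> cls j}. 2 powi k * ?u k j)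
          \<le> 4 * (alphap j + alpham j) + 2 * (weight I j * p j)"
        using class_arr_le[OF j] by linarith
    qed
    finally show "(\<Sum>j\<in>jobs I - R. \<Sum>k\<in>{k\<in>K. k \<le> cls j}. 2 powi k * ?u k j)
        \<le> (\<Sum>j\<in>jobs I. 4 * (alphap j + alpham j) + 2 * (weight I j * p j))" .
  qed auto
  also have "\<dots> = 4 * wp / \<epsilon> + 4 * wp + 8 * (\<Sum>j\<in>jobs I. alphap j + alpham j)"
    by (simp add: sum.distrib sum_distrib_left[symmetric] wp_def)
  finally show ?thesis .
qed

subsection \<open>Charging to the rejected jobs\<close>

text \<open>A time-independent bound for the square of \<open>volA\<close>: twice the bound for
  \<open>volQ\<close> squared plus twice the bound for the excess squared.\<close>

definition "vol_bound k = 2 * (2 * (\<Sum>t\<in>{a..<T}. volQ k t)) + 2 * (3 * (\<Sum>t\<in>{a..<T}. delayed k t))"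

lemma vol_bound_nonneg: "0 \<le> vol_bound k"
  unfolding vol_bound_def using volQ_nonneg delayed_nonneg
  by (intro add_nonneg_nonneg mult_nonneg_nonneg sum_nonneg) auto

lemma volA_le_sqrt_vol_bound:
  assumes "a \<le> t" "t \<le> T"
  shows "volA k t \<le> sqrt (vol_bound k)"
proof -
  let ?e = "max 0 (volA k t - volQ k t)"
  have "(\<Sum>j\<in>rel_upto (dense R k) t. max 0 (2 * p j * (arrA k j - arrQ k j) - (p j)\<^sup>2)) \<ge> 0"
    by (intro sum_nonneg) simp
  then have e: "?e\<^sup>2 \<le> 3 * (\<Sum>t\<in>{a..<T}. delayed k t)"
    using excess_potential[OF assms, of k] by linarith
  have "(volA k t)\<^sup>2 \<le> (volQ k t + ?e)\<^sup>2"
    using volA_nonneg by (intro power_mono) auto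
  also have "\<dots> \<le> 2 * (volQ k t)\<^sup>2 + 2 * ?e\<^sup>2"
    using sum_squares_bound[of "volQ k t" ?e] by (simp add: power2_sum)
  also have "\<dots> \<le> vol_bound k"
    unfolding vol_bound_def using e volQ_power2_le[OF assms(1), of k] by (intro add_mono mult_left_mono) auto
  finally show ?thesis by (rule real_le_rsqrt)
qed

lemma vol_bound_sum_le: "(\<Sum>k\<in>K. 2 powi k * vol_bound k) \<le> 8 * F + 12 * wp / \<epsilon>"
proof -
  have "(\<Sum>k\<in>K. 2 powi k * vol_bound k) = 2 * (\<Sum>k\<in>K. 2 powi k * (2 * (\<Sum>t\<in>{a..<T}. volQ k t)))
      + 6 * (\<Sum>k\<in>K. 2 powi k * (\<Sum>t\<in>{a..<T}. delayed k t))"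
    unfolding vol_bound_def sum_distrib_left sum.distrib[symmetric]
    by (simp add: algebra_simps sum_distrib_left)
  then show ?thesis
    using volQ_sum_le delayed_total_le by simp
qed

text \<open>Up to a factor 2, a time-independent bound for the active weight in classes below
  \<open>i\<close>.\<close>

definition "lower_weight i = (\<Sum>k\<in>{k\<in>K. k < i}. 2 powi k * sqrt (vol_bound k))"

lemma lower_weight_nonneg: "0 \<le> lower_weight i"
  unfolding lower_weight_def using vol_bound_nonneg by (intro sum_nonneg mult_nonneg_nonneg) auto

lemma alpham_le:
  assumes "j \<in> jobs I"
  shows "alpham j \<le> 2 * (p j * lower_weight (cls j))"
proof -
  let ?r = "release I j"
  let ?X = "{i\<in>rel_upto (jobs I - R) ?r. cls i < cls j}"
  have r: "a \<le> ?r" "?r \<le> T"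
    using start[OF assms] horizon(2)[OF assms] by auto
  have fin: "finite ?X" using finite_jobs by simp
  have "(\<Sum>i\<in>D_minus I S R j. remaining_weight I A i ?r) \<le> (\<Sum>i\<in>?X. remaining_weight I A i ?r)"
    using fin density_pos remaining_A_nonneg
    by (intro sum_mono2)
      (auto simp: D_minus_def D_plus_def active_on_arrival_def active_def remaining_weight_def less_imp_le)
  also have "\<dots> \<le> (\<Sum>i\<in>?X. 2 * (2 powi cls i * remaining I A i ?r))"
  proof (rule sum_mono)
    fix i assume "i \<in> ?X"
    then have i: "i \<in> jobs I" by simp
    then show "remaining_weight I A i ?r \<le> 2 * (2 powi cls i * remaining I A i ?r)"
      using remaining_A_nonneg[OF i] less_imp_le[OF cls_gt[OF i]]
      by (simp add: remaining_weight_def mult_right_mono flip: mult.assoc)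
  qed
  also have "\<dots> = 2 * (\<Sum>i\<in>?X. 2 powi cls i * remaining I A i ?r)"
    by (simp add: sum_distrib_left)
  also have "(\<Sum>i\<in>?X. 2 powi cls i * remaining I A i ?r)
      \<le> (\<Sum>k\<in>{k\<in>K. k < cls j}. 2 powi k * (\<Sum>i\<in>dense ?X k. remaining I A i ?r))"
    using finite_K fin remaining_A_nonneg by (intro class_sum_ge) (auto simp: K_def)
  also have "\<dots> \<le> lower_weight (cls j)"
    unfolding lower_weight_def
  proof (intro sum_mono mult_left_mono)
    fix k
    have "(\<Sum>i\<in>dense ?X k. remaining I A i ?r) \<le> volA k ?r"
      unfolding class_vol_eq using finite_jobs remaining_A_nonneg by (intro sum_mono2) auto
    then show "(\<Sum>i\<in>dense ?X k. remaining I A i ?r) \<le> sqrt (vol_bound k)"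
      using volA_le_sqrt_vol_bound[OF r, of k] by linarith
  qed auto
  finally have "(\<Sum>i\<in>D_minus I S R j. remaining_weight I A i ?r) \<le> 2 * lower_weight (cls j)"
    by simp
  from mult_left_mono[OF this, of "p j"] show ?thesis
    by (simp add: alpha_minus_def)
qed

abbreviation "N \<equiv> nat \<lfloor>1 / \<epsilon>\<rfloor>"

lemma N_eq: "real N = 1 / \<epsilon>"
  using inverse_eps_Ints eps_pos by (auto elim!: Ints_cases)

lemma N_pos: "0 < N"
  using N_eq eps_pos by (metis divide_pos_pos of_nat_0_less_iff zero_less_one)

lemma wp_job_pos: "j \<in> jobs I \<Longrightarrow> 0 < weight I j * p j / \<epsilon>"
  using weight_pos proc_pos eps_pos by simp

text \<open>A bucket fixes both \<open>alphap j / weight I j\<close> and \<open>weight I j\<close>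
  up to a factor 2, hence \<open>alphap j\<close> up to 4. Its first job is rejected, so no job is
  left unpaid; unassigned jobs cost less than \<open>weight I j * p j / \<epsilon>\<close>.\<close>

lemma alphap_sum_le: "(\<Sum>j\<in>jobs I. alphap j) \<le> wp / \<epsilon> + 4 / \<epsilon> * (\<Sum>j\<in>R. alphap j)"
proof -
  let ?P = "{j\<in>jobs I. assigned_plus I \<epsilon> S R j}"
  let ?b = "bucket_plus I S R"
  let ?rej = "rejected_plus I \<epsilon> S R"
  let ?lo = "\<lambda>(x, y). 2 powi x * (2::real) powi y"
  have fin: "finite ?P" using finite_jobs by simp
  have "(\<Sum>j\<in>?P. alphap j) \<le> 4 * real N * (\<Sum>j\<in>{j\<in>?P. ?rej j}. alphap j) + (\<Sum>\<beta>\<in>?b ` ?P. real 0 * 4 * ?lo \<beta>)"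
  proof (rule bucket_sum_le[OF fin])
    fix j assume j: "j \<in> ?P"
    then have jJ: "j \<in> jobs I" by simp
    have w: "0 < weight I j" by (rule weight_pos[OF jJ])
    have "0 < alphap j" using j wp_job_pos[OF jJ] by (simp add: assigned_plus_def)
    then have x: "0 < alphap j / weight I j" using w by simp
    let ?x = "2 powi floor2 (alphap j / weight I j) :: real" and ?y = "2 powi floor2 (weight I j) :: real"
    have eq: "alphap j = alphap j / weight I j * weight I j" using w by simp
    have "?x * ?y \<le> alphap j / weight I j * weight I j"
      using floor2_bounds[OF x] floor2_bounds[OF w] w x by (intro mult_mono) auto
    moreover have "alphap j / weight I j * weight I j \<le> 2 * ?x * (2 * ?y)"
      using floor2_bounds[OF x] floor2_bounds[OF w] w x by (intro mult_mono) auto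
    ultimately show "0 \<le> ?lo (?b j) \<and> ?lo (?b j) \<le> alphap j \<and> alphap j \<le> 4 * ?lo (?b j)"
      using eq by (simp add: bucket_plus_def)
  next
    fix \<beta>
    let ?B = "{j\<in>?P. ?b j = \<beta>}"
    have finB: "finite ?B" using finite_jobs by simp
    have "{j\<in>{j\<in>?P. ?rej j}. ?b j = \<beta>} = {j\<in>?B. N dvd card {i\<in>?B. before I i j}}"
    proof -
      have "earlier_in_bucket_plus I \<epsilon> S R j = {i\<in>?B. before I i j}" if "?b j = \<beta>" for j
        using that by (auto simp: earlier_in_bucket_plus_def)
      then show ?thesis by (auto simp: rejected_plus_def)
    qed
    then have "card {j\<in>{j\<in>?P. ?rej j}. ?b j = \<beta>} = card {m. m < card ?B \<and> N dvd m}"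
      using card_rank_filter[OF finB, of "\<lambda>m. N dvd m" I] by (simp only:)
    then show "card ?B \<le> N * card {j\<in>{j\<in>?P. ?rej j}. ?b j = \<beta>} + 0"
      using le_mult_card_dvd[OF N_pos, of "card ?B"] by (simp only: add_0_right)
  qed simp
  also have "\<dots> \<le> 4 / \<epsilon> * (\<Sum>j\<in>R. alphap j)"
  proof -
    have "{j\<in>?P. ?rej j} \<subseteq> R" using run by (auto simp: algorithm_run_def)
    then have "(\<Sum>j\<in>{j\<in>?P. ?rej j}. alphap j) \<le> (\<Sum>j\<in>R. alphap j)"
      using finite_sub[OF R_subset] R_subset alphap_nonneg by (intro sum_mono2) auto
    then show ?thesis
      using eps_pos by (simp add: N_eq divide_right_mono)
  qed
  finally have assigned: "(\<Sum>j\<in>?P. alphap j) \<le> 4 / \<epsilon> * (\<Sum>j\<in>R. alphap j)" .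
  have "(\<Sum>j\<in>jobs I. alphap j) = (\<Sum>j\<in>jobs I - ?P. alphap j) + (\<Sum>j\<in>?P. alphap j)"
    using finite_jobs by (intro sum.subset_diff) auto
  moreover have "(\<Sum>j\<in>jobs I - ?P. alphap j) \<le> (\<Sum>j\<in>jobs I - ?P. weight I j * p j / \<epsilon>)"
    by (intro sum_mono) (auto simp: assigned_plus_def)
  moreover have "\<dots> \<le> (\<Sum>j\<in>jobs I. weight I j * p j / \<epsilon>)"
    using finite_jobs wp_job_pos by (intro sum_mono2) (auto simp: less_imp_le)
  ultimately show ?thesis
    using assigned by (simp add: wp_def sum_divide_distrib)
qed

text \<open>In each bucket of \<open>T\<^sup>-\<close> fewer than \<open>1/\<epsilon>\<close> jobs are not covered by a rejection.  Their total
  is bounded without reference to the number of buckets, since their indices \<open>x\<close> and \<open>m\<close>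
  are bounded by \<open>lower_weight i\<close>.\<close>

lemma minus_buckets_le:
  "(\<Sum>(x, i, m)\<in>bucket_minus I S R ` {j\<in>jobs I. assigned_minus I \<epsilon> S R j}. real N * 2 * 2 powi x)
    \<le> 384 * (\<Sum>k\<in>K. 2 powi k * vol_bound k)"
proof -
  let ?B = "bucket_minus I S R ` {j\<in>jobs I. assigned_minus I \<epsilon> S R j}"
  let ?W = lower_weight
  \<comment> \<open>Assignment to the table and \<open>alpham_le\<close> give
    \<open>weight I j / \<epsilon> < 2 * ?W i\<close>, while \<open>weight I j\<close> is at least
    \<open>2 powi i * 2 powi m\<close>.\<close>
  define Ms where "Ms i = {m \<in> (\<lambda>j. floor2 (p j)) ` jobs I. 2 powi m \<le> 2 * ?W i / (real N * 2 powi i)}" for i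
  \<comment> \<open>From \<open>alpham_le\<close> and \<open>p j < 2 * 2 powi m\<close>.\<close>
  define Xs where "Xs i m = {x \<in> fst ` ?B. 2 powi x \<le> 4 * 2 powi m * ?W i}" for i m
  \<comment> \<open>Reorders the indices so that \<open>x\<close> is summed first, under a bound
    depending on \<open>i\<close> and \<open>m\<close>, then \<open>m\<close>, then
    \<open>i\<close>.\<close>
  define g :: "int \<times> int \<times> int \<Rightarrow> int \<times> int \<times> int" where "g = (\<lambda>(i, m, x). (x, i, m))"
  have finB: "finite ?B" using finite_jobs by simp
  have fin: "finite (Ms i)" "finite (Xs i m)" for i m
    using finite_jobs finB by (auto simp: Ms_def Xs_def)
  have sub: "?B \<subseteq> g ` (SIGMA i:K. SIGMA m:Ms i. Xs i m)"
  proof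
    fix b assume b: "b \<in> ?B"
    then obtain j where j: "j \<in> jobs I" "assigned_minus I \<epsilon> S R j" "b = bucket_minus I S R j" by auto
    have gt: "weight I j * p j / \<epsilon> < alpham j" using j(2) by (simp add: assigned_minus_def)
    then have pos: "0 < alpham j" using wp_job_pos[OF j(1)] by simp
    have p: "0 < p j" using proc_pos[OF j(1)] by simp
    let ?x = "floor2 (alpham j)" and ?m = "floor2 (p j)"
    have "2 powi ?x \<le> alpham j" by (rule floor2_bounds(1)[OF pos])
    also have "\<dots> \<le> 2 * (p j * ?W (cls j))" by (rule alpham_le[OF j(1)])
    also have "\<dots> \<le> 2 * (2 * 2 powi ?m * ?W (cls j))"
      using floor2_bounds(2)[OF p] lower_weight_nonneg by (intro mult_left_mono mult_right_mono) auto
    finally have X: "2 powi ?x \<le> 4 * 2 powi ?m * ?W (cls j)" by simp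
    have "p j * (weight I j / \<epsilon>) < p j * (2 * ?W (cls j))"
      using gt alpham_le[OF j(1)] by (simp add: algebra_simps)
    then have "weight I j / \<epsilon> < 2 * ?W (cls j)" by (rule mult_left_less_imp_less) simp
    moreover have "real N * (2 powi cls j * 2 powi ?m) \<le> real N * weight I j"
      unfolding weight_eq[OF j(1)]
      using cls_le[OF j(1)] floor2_bounds(1)[OF p] density_pos[OF j(1)]
      by (intro mult_left_mono mult_mono) auto
    ultimately have "2 powi ?m * (real N * 2 powi cls j) \<le> 2 * ?W (cls j)"
      by (simp add: N_eq algebra_simps)
    then have M: "2 powi ?m \<le> 2 * ?W (cls j) / (real N * 2 powi cls j)"
      using N_pos by (simp add: pos_le_divide_eq)
    have "(cls j, ?m, ?x) \<in> (SIGMA i:K. SIGMA m:Ms i. Xs i m)"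
      using j(1) M X b[unfolded j(3)] imageI[OF b, of fst]
      by (auto simp: Ms_def Xs_def K_def j(3) bucket_minus_def)
    moreover have "b = g (cls j, ?m, ?x)" by (simp add: j(3) bucket_minus_def g_def)
    ultimately show "b \<in> g ` (SIGMA i:K. SIGMA m:Ms i. Xs i m)" by blast
  qed
  have "(\<Sum>(x, i, m)\<in>?B. real N * 2 * 2 powi x)
      \<le> (\<Sum>(x, i, m)\<in>g ` (SIGMA i:K. SIGMA m:Ms i. Xs i m). real N * 2 * 2 powi x)"
    using sub finite_K fin by (intro sum_mono2) auto
  also have "\<dots> = (\<Sum>(i, m, x)\<in>(SIGMA i:K. SIGMA m:Ms i. Xs i m). real N * 2 * 2 powi x)"
    by (subst sum.reindex) (auto simp: inj_on_def g_def intro!: sum.cong)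
  also have "\<dots> = (\<Sum>i\<in>K. \<Sum>m\<in>Ms i. \<Sum>x\<in>Xs i m. real N * 2 * 2 powi x)"
    using finite_K fin by (simp add: sum.Sigma split_def)
  also have "\<dots> \<le> (\<Sum>i\<in>K. 64 * ((?W i)\<^sup>2 / 2 powi i))"
  proof (rule sum_mono)
    fix i
    have "(\<Sum>m\<in>Ms i. \<Sum>x\<in>Xs i m. real N * 2 * 2 powi x) \<le> (\<Sum>m\<in>Ms i. real N * 2 * (2 * (4 * 2 powi m * ?W i)))"
    proof (rule sum_mono)
      fix m
      have "(\<Sum>x\<in>Xs i m. 2 powi x) \<le> 2 * (4 * 2 powi m * ?W i)"
        using fin lower_weight_nonneg by (intro sum_powi2_le) (auto simp: Xs_def)
      then show "(\<Sum>x\<in>Xs i m. real N * 2 * 2 powi x) \<le> real N * 2 * (2 * (4 * 2 powi m * ?W i))"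
        unfolding sum_distrib_left[symmetric] by (rule mult_left_mono) simp
    qed
    also have "\<dots> = real N * 16 * ?W i * (\<Sum>m\<in>Ms i. 2 powi m)"
      unfolding sum_distrib_left by (intro sum.cong refl) simp
    \<comment> \<open>The bound on \<open>m\<close> contains \<open>real N\<close> in its
      denominator and cancels the number of unpaid jobs per bucket.\<close>
    also have "\<dots> \<le> real N * 16 * ?W i * (2 * (2 * ?W i / (real N * 2 powi i)))"
      using fin lower_weight_nonneg by (intro mult_left_mono sum_powi2_le) (auto simp: Ms_def)
    also have "\<dots> = 64 * ((?W i)\<^sup>2 / 2 powi i)"
      using N_pos by (simp add: power2_eq_square)
    finally show "(\<Sum>m\<in>Ms i. \<Sum>x\<in>Xs i m. real N * 2 * 2 powi x) \<le> 64 * ((?W i)\<^sup>2 / 2 powi i)" .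
  qed
  also have "\<dots> = 64 * (\<Sum>i\<in>K. (?W i)\<^sup>2 / 2 powi i)"
    by (simp add: sum_distrib_left)
  also have "\<dots> \<le> 64 * (6 * (\<Sum>k\<in>K. 2 powi k * (sqrt (vol_bound k))\<^sup>2))"
    unfolding lower_weight_def by (intro mult_left_mono hardy_powi finite_K) simp
  finally show ?thesis using vol_bound_nonneg by simp
qed

text \<open>The first bucket index alone fixes \<open>alpham j\<close> up to a factor 2. Rejection
  starts only with job number \<open>N\<close>, so up to \<open>N\<close> jobs per bucket are unpaid
  and are handled by \<open>minus_buckets_le\<close>.\<close>

lemma alpham_sum_le:
  "(\<Sum>j\<in>jobs I. alpham j) \<le> wp / \<epsilon> + 2 / \<epsilon> * (\<Sum>j\<in>R. alpham j) + 384 * (\<Sum>k\<in>K. 2 powi k * vol_bound k)"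
proof -
  let ?P = "{j\<in>jobs I. assigned_minus I \<epsilon> S R j}"
  let ?b = "bucket_minus I S R"
  let ?rej = "rejected_minus I \<epsilon> S R"
  let ?lo = "\<lambda>(x, i, m). (2::real) powi x"
  have fin: "finite ?P" using finite_jobs by simp
  have "(\<Sum>j\<in>?P. alpham j) \<le> 2 * real N * (\<Sum>j\<in>{j\<in>?P. ?rej j}. alpham j) + (\<Sum>\<beta>\<in>?b ` ?P. real N * 2 * ?lo \<beta>)"
  proof (rule bucket_sum_le[OF fin])
    fix j assume j: "j \<in> ?P"
    then have jJ: "j \<in> jobs I" by simp
    have "0 < alpham j" using j wp_job_pos[OF jJ] by (simp add: assigned_minus_def)
    then show "0 \<le> ?lo (?b j) \<and> ?lo (?b j) \<le> alpham j \<and> alpham j \<le> 2 * ?lo (?b j)"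
      using floor2_bounds[of "alpham j"] by (simp add: bucket_minus_def)
  next
    fix \<beta>
    let ?B = "{j\<in>?P. ?b j = \<beta>}"
    have finB: "finite ?B" using finite_jobs by simp
    have "{j\<in>{j\<in>?P. ?rej j}. ?b j = \<beta>} = {j\<in>?B. N dvd card {i\<in>?B. before I i j} + 1}"
    proof -
      have "earlier_in_bucket_minus I \<epsilon> S R j = {i\<in>?B. before I i j}" if "?b j = \<beta>" for j
        using that by (auto simp: earlier_in_bucket_minus_def)
      then show ?thesis by (auto simp: rejected_minus_def)
    qed
    then have "card {j\<in>{j\<in>?P. ?rej j}. ?b j = \<beta>} = card {m. m < card ?B \<and> N dvd m + 1}"
      using card_rank_filter[OF finB, of "\<lambda>m. N dvd m + 1" I] by (simp only:)
    then show "card ?B \<le> N * card {j\<in>{j\<in>?P. ?rej j}. ?b j = \<beta>} + N"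
      using le_mult_card_dvd_Suc[OF N_pos, of "card ?B"] by (simp only:)
  qed simp
  also have "(\<Sum>\<beta>\<in>?b ` ?P. real N * 2 * ?lo \<beta>) = (\<Sum>(x, i, m)\<in>?b ` ?P. real N * 2 * 2 powi x)"
    by (intro sum.cong) auto
  also note minus_buckets_le
  also have "2 * real N * (\<Sum>j\<in>{j\<in>?P. ?rej j}. alpham j) \<le> 2 / \<epsilon> * (\<Sum>j\<in>R. alpham j)"
  proof -
    have "{j\<in>?P. ?rej j} \<subseteq> R" using run by (auto simp: algorithm_run_def)
    then have "(\<Sum>j\<in>{j\<in>?P. ?rej j}. alpham j) \<le> (\<Sum>j\<in>R. alpham j)"
      using finite_sub[OF R_subset] R_subset alpham_nonneg by (intro sum_mono2) auto
    then show ?thesis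
      using eps_pos by (simp add: N_eq divide_right_mono)
  qed
  finally have assigned: "(\<Sum>j\<in>?P. alpham j) \<le> 2 / \<epsilon> * (\<Sum>j\<in>R. alpham j) + 384 * (\<Sum>k\<in>K. 2 powi k * vol_bound k)"
    by simp
  have "(\<Sum>j\<in>jobs I. alpham j) = (\<Sum>j\<in>jobs I - ?P. alpham j) + (\<Sum>j\<in>?P. alpham j)"
    using finite_jobs by (intro sum.subset_diff) auto
  moreover have "(\<Sum>j\<in>jobs I - ?P. alpham j) \<le> (\<Sum>j\<in>jobs I - ?P. weight I j * p j / \<epsilon>)"
    by (intro sum_mono) (auto simp: assigned_minus_def)
  moreover have "\<dots> \<le> (\<Sum>j\<in>jobs I. weight I j * p j / \<epsilon>)"
    using finite_jobs wp_job_pos by (intro sum_mono2) (auto simp: less_imp_le)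
  ultimately show ?thesis
    using assigned by (simp add: wp_def sum_divide_distrib)
qed

lemma flow_le: "flow A (jobs I - R) \<le> 321344 / \<epsilon>\<^sup>2 * F"
proof -
  define \<alpha> where "\<alpha> G = (\<Sum>j\<in>G. alphap j + alpham j)" for G
  have F: "0 \<le> F"
    using wp_nonneg wp_le by linarith
  have le1: "F \<le> F / \<epsilon>"
    using F eps_pos eps_le by (simp add: pos_le_divide_eq mult_left_le)
  have le2: "F / \<epsilon> \<le> F / \<epsilon>\<^sup>2"
    using divide_right_mono[OF le1, of \<epsilon>] eps_pos by (simp add: power2_eq_square)
  have wp: "wp / \<epsilon> \<le> 8 * (F / \<epsilon>)"
    using divide_right_mono[OF wp_le, of \<epsilon>] eps_pos by simp
  \<comment> \<open>With \<open>wp \<le> 8 * F\<close>, \<open>52 = 4 + 6 * 8\<close> here and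
    \<open>104 = 8 + 12 * 8\<close> below.\<close>
  have R: "\<alpha> R \<le> 52 * (F / \<epsilon>)"
    using alpha_rejected_le wp le1 by (simp add: \<alpha>_def)
  have Y: "(\<Sum>k\<in>K. 2 powi k * vol_bound k) \<le> 104 * (F / \<epsilon>)"
    using vol_bound_sum_le wp le1 by simp
  have "0 \<le> (\<Sum>j\<in>R. alpham j)"
    using R_subset alpham_nonneg by (intro sum_nonneg) auto
  then have "2 / \<epsilon> * (\<Sum>j\<in>R. alpham j) \<le> 4 / \<epsilon> * (\<Sum>j\<in>R. alpham j)"
    using eps_pos by (intro mult_right_mono divide_right_mono) auto
  then have "\<alpha> (jobs I) \<le> 2 * (wp / \<epsilon>) + 4 / \<epsilon> * \<alpha> R + 384 * (\<Sum>k\<in>K. 2 powi k * vol_bound k)"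
    using alphap_sum_le alpham_sum_le by (simp add: \<alpha>_def sum.distrib distrib_left)
  also have "\<dots> \<le> 2 * (wp / \<epsilon>) + 4 / \<epsilon> * (52 * (F / \<epsilon>)) + 384 * (104 * (F / \<epsilon>))"
    using R Y eps_pos by (intro add_mono mult_left_mono) auto
  also have "4 / \<epsilon> * (52 * (F / \<epsilon>)) = 208 * (F / \<epsilon>\<^sup>2)"
    by (simp add: power2_eq_square)
  \<comment> \<open>\<open>40160 = 2 * 8 + 208 + 384 * 104\<close>; then
    \<open>321344 = 4 * 8 + 4 * 8 + 8 * 40160\<close>.\<close>
  finally have "\<alpha> (jobs I) \<le> 40160 * (F / \<epsilon>\<^sup>2)"
    using wp le2 by linarith
  then have "flow A (jobs I - R) \<le> 321344 * (F / \<epsilon>\<^sup>2)"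
    using flow_A_le wp wp_le le1 le2 unfolding \<alpha>_def by linarith
  then show ?thesis by simp
qed

end

subsection \<open>Infinite horizon\<close>

lemma frac_flow_ge:
  assumes "\<And>t. 0 \<le> remaining_weight I x j t"
  shows "ennreal (\<Sum>t\<in>{release I j..<T}. remaining_weight I x j t) \<le> frac_flow I x j"
proof -
  have "ennreal (\<Sum>t\<in>{release I j..<T}. remaining_weight I x j t)
      = (\<Sum>t\<in>{release I j..<T}. ennreal (remaining_weight I x j t))"
    using assms by (simp add: sum_ennreal)
  also have "\<dots> \<le> frac_flow I x j"
    unfolding frac_flow_def by (subst nonneg_infsum_complete) (auto intro!: SUP_upper)
  finally show ?thesis .
qed

text \<open>The infinite sum is a supremum over finite sets of times, and each such set lies in an
  initial segment, whatever the offset \<open>T\<close>.\<close>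

lemma frac_flow_le:
  assumes "\<And>t. 0 \<le> remaining_weight I x j t"
  shows "frac_flow I x j \<le> (SUP n. ennreal (\<Sum>t\<in>{release I j..<T + int n}. remaining_weight I x j t))"
  unfolding frac_flow_def
proof (subst nonneg_infsum_complete, simp, rule SUP_least)
  fix X assume X: "X \<in> {X. finite X \<and> X \<subseteq> {release I j..}}"
  then have "bdd_above X" by auto
  then obtain b where b: "\<And>t. t \<in> X \<Longrightarrow> t \<le> b" by (auto simp: bdd_above_def)
  have "X \<subseteq> {release I j..<T + int (nat (b + 1 - T))}"
  proof
    fix t assume "t \<in> X"
    then have "release I j \<le> t" "t \<le> b" using X b by auto
    then show "t \<in> {release I j..<T + int (nat (b + 1 - T))}" by simp
  qed
  then have "sum (\<lambda>t. ennreal (remaining_weight I x j t)) X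
      \<le> (\<Sum>t\<in>{release I j..<T + int (nat (b + 1 - T))}. ennreal (remaining_weight I x j t))"
    by (intro sum_mono2) auto
  also have "\<dots> = ennreal (\<Sum>t\<in>{release I j..<T + int (nat (b + 1 - T))}. remaining_weight I x j t)"
    using assms by (simp add: sum_ennreal)
  also have "\<dots> \<le> (SUP n. ennreal (\<Sum>t\<in>{release I j..<T + int n}. remaining_weight I x j t))"
    by (rule SUP_upper) simp
  finally show "sum (\<lambda>t. ennreal (remaining_weight I x j t)) X
      \<le> (SUP n. ennreal (\<Sum>t\<in>{release I j..<T + int n}. remaining_weight I x j t))" .
qed

context run_analysis
begin

lemma flow_eq:
  assumes "G \<subseteq> jobs I"
  shows "flow y G = (\<Sum>j\<in>G. \<Sum>t\<in>{release I j..<T}. remaining_weight I y j t)"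
proof -
  have "flow y G = (\<Sum>j\<in>G. \<Sum>t\<in>{t\<in>{a..<T}. release I j \<le> t}. remaining_weight I y j t)"
    unfolding flow_def by (intro sum.swap_restrict finite_sub assms) simp
  also have "\<dots> = (\<Sum>j\<in>G. \<Sum>t\<in>{release I j..<T}. remaining_weight I y j t)"
  proof (intro sum.cong refl)
    fix j assume "j \<in> G"
    then have "a < release I j" using assms start by auto
    then show "{t\<in>{a..<T}. release I j \<le> t} = {release I j..<T}" by auto
  qed
  finally show ?thesis .
qed

lemma remaining_weight_nonneg:
  assumes "j \<in> jobs I"
  shows "0 \<le> remaining_weight I A j t" "0 \<le> remaining_weight I Q j t"
  using density_pos[OF assms] remaining_A_nonneg[OF assms] remaining_Q_nonneg[OF assms]
  by (simp_all add: remaining_weight_def)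

text \<open>The right-hand side does not depend on \<open>T\<close>, so the bound survives the
  supremum over all horizons.\<close>

lemma ennreal_flow_le:
  "(\<Sum>j\<in>jobs I - R. ennreal (\<Sum>t\<in>{release I j..<T}. remaining_weight I A j t))
    \<le> ennreal (321344 / \<epsilon>\<^sup>2) * (\<Sum>j\<in>jobs I. frac_flow I Q j)"
proof -
  have "(\<Sum>j\<in>jobs I - R. ennreal (\<Sum>t\<in>{release I j..<T}. remaining_weight I A j t))
      = ennreal (flow A (jobs I - R))"
    unfolding flow_eq[OF Diff_subset] using remaining_weight_nonneg
    by (intro sum_ennreal sum_nonneg) auto
  also have "\<dots> \<le> ennreal (321344 / \<epsilon>\<^sup>2 * F)"
    by (intro ennreal_leI flow_le)
  also have "\<dots> = ennreal (321344 / \<epsilon>\<^sup>2) * ennreal F"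
    using wp_nonneg wp_le by (intro ennreal_mult) auto
  also have "ennreal F = (\<Sum>j\<in>jobs I. ennreal (\<Sum>t\<in>{release I j..<T}. remaining_weight I Q j t))"
    unfolding flow_eq[OF order_refl] using remaining_weight_nonneg
    by (intro sum_ennreal[symmetric] sum_nonneg) auto
  also have "\<dots> \<le> (\<Sum>j\<in>jobs I. frac_flow I Q j)"
    by (intro sum_mono frac_flow_ge remaining_weight_nonneg)
  finally show ?thesis by (simp add: mult_left_mono)
qed

end

theorem theorem4p8:
  shows "\<exists>C::real. C > 0 \<and>
    (\<forall>(I::job_instance) (\<epsilon>::real) (S::int \<Rightarrow> nat option) (J_imm::nat set) (Q::schedule).
       valid_instance I \<longrightarrow> \<epsilon> > 0 \<longrightarrow> \<epsilon>\<^sup>2 \<le> 1 / 2 \<longrightarrow> 1 / \<epsilon> \<in> \<int> \<longrightarrow>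
       algorithm_run I \<epsilon> S J_imm \<longrightarrow> optimal_schedule I Q \<longrightarrow>
       (\<Sum>j\<in>jobs I - J_imm. frac_flow I (slot_schedule S) j)
         \<le> ennreal (C / \<epsilon>\<^sup>2) * (\<Sum>j\<in>jobs I. frac_flow I Q j))"
proof (intro exI[of _ "321344 :: real"] conjI allI impI)
  fix I \<epsilon> S J_imm Q
  assume valid: "valid_instance I" and eps: "(0::real) < \<epsilon>" "\<epsilon>\<^sup>2 \<le> 1 / 2" "1 / \<epsilon> \<in> \<int>"
    and run: "algorithm_run I \<epsilon> S J_imm" and opt: "optimal_schedule I Q"
  have fin: "finite (jobs I)" and feas: "feasible_schedule I Q"
    using valid opt by (simp_all add: valid_instance_def optimal_schedule_def)
  have "\<epsilon> \<le> 1"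
    using eps(1,2) power_le_one_iff[of \<epsilon> 2] by simp
  have "\<forall>j\<in>jobs I. \<exists>t. remaining I Q j t = 0"
    using feas by (simp add: feasible_schedule_def)
  then obtain f where f: "\<And>j. j \<in> jobs I \<Longrightarrow> remaining I Q j (f j) = 0"
    by metis
  \<comment> \<open>The inserted 0 keeps the minimum defined without jobs; subtracting 1 makes the
    window open strictly before every release.\<close>
  define a where "a = Min (insert 0 (release I ` jobs I)) - 1"
  define T where "T = Max (insert a (f ` jobs I \<union> release I ` jobs I))"
  have a: "a < release I j" if "j \<in> jobs I" for j
  proof -
    have "Min (insert 0 (release I ` jobs I)) \<le> release I j"
      using fin that by (intro Min_le) auto
    then show ?thesis by (simp add: a_def)
  qed
  have T: "a \<le> T" "\<And>j. j \<in> jobs I \<Longrightarrow> release I j \<le> T" "\<And>j. j \<in> jobs I \<Longrightarrow> f j \<le> T"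
    unfolding T_def using fin by (auto intro!: Max_ge)
  \<comment> \<open>Past its completion a job of \<open>Q\<close> stays at remaining time zero,
    since remaining times never increase and are nonnegative.\<close>
  have analysis: "run_analysis I \<epsilon> S J_imm Q a (T + int n)" for n
  proof
    fix j assume j: "j \<in> jobs I"
    show "release I j \<le> T + int n" using T(2)[OF j] by simp
    have "(\<Sum>s\<in>{release I j..<f j}. Q s j) \<le> (\<Sum>s\<in>{release I j..<T + int n}. Q s j)"
      using T(3)[OF j] feas by (intro sum_mono2) (auto simp: feasible_schedule_def)
    then have "remaining I Q j (T + int n) \<le> remaining I Q j (f j)"
      by (simp add: remaining_def)
    moreover have "0 \<le> remaining I Q j (T + int n)"
      using feas j by (simp add: feasible_schedule_def)
    ultimately show "remaining I Q j (T + int n) = 0"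
      using f[OF j] by simp
  qed (use valid eps \<open>\<epsilon> \<le> 1\<close> run feas a T(1) in \<open>auto simp: valid_instance_def\<close>)
  let ?rw = "remaining_weight I (slot_schedule S)"
  let ?s = "\<lambda>j n. ennreal (\<Sum>t\<in>{release I j..<T + int n}. ?rw j t)"
  have nonneg: "0 \<le> ?rw j t" if "j \<in> jobs I" for j t
    using run_analysis.remaining_weight_nonneg(1)[OF analysis that] .
  have "(\<Sum>j\<in>jobs I - J_imm. frac_flow I (slot_schedule S) j) \<le> (\<Sum>j\<in>jobs I - J_imm. SUP n. ?s j n)"
    using nonneg by (intro sum_mono frac_flow_le) auto
  \<comment> \<open>The truncated flow-times increase with the horizon, so the supremum commutes
    with the finite sum.\<close>
  also have "\<dots> = (SUP n. \<Sum>j\<in>jobs I - J_imm. ?s j n)"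
  proof (intro ennreal_SUP_sum[symmetric] incseq_SucI ennreal_leI)
    fix j n assume "j \<in> jobs I - J_imm"
    then show "(\<Sum>t\<in>{release I j..<T + int n}. ?rw j t) \<le> (\<Sum>t\<in>{release I j..<T + int (Suc n)}. ?rw j t)"
      using nonneg by (intro sum_mono2) auto
  qed
  also have "\<dots> \<le> ennreal (321344 / \<epsilon>\<^sup>2) * (\<Sum>j\<in>jobs I. frac_flow I Q j)"
    by (intro SUP_least run_analysis.ennreal_flow_le[OF analysis])
  finally show "(\<Sum>j\<in>jobs I - J_imm. frac_flow I (slot_schedule S) j)
      \<le> ennreal (321344 / \<epsilon>\<^sup>2) * (\<Sum>j\<in>jobs I. frac_flow I Q j)" .
qed simp

end
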